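(* Let $F$ be a field. Let $p_1\in F[X]$ be a monic irreducible polynomial of degree $d$. Given $m>1$, put $p_i(X)=p_1(X+(i-1))$ for $1\le i\le m$, and let $s_1\ge\cdots\ge s_m$ be positive integers. Let $U$ be the torsion $F[X]$-module $U=F[X]u_1\oplus\cdots\oplus F[X]u_m$ with $\mathrm{Ann}_{F[X]}(u_i)=(p_i^{s_i})$ for $1\le i\le m$, and let $A,T,E\in\mathrm{End}_F(U)$ be the operators defined in the context. Let $\mathfrak h=\langle y\rangle\ltimes\mathfrak a$, where $\mathrm{ad}\,y$ acts diagonalizably on the abelian Lie algebra $\mathfrak a$. For $\gamma\in F$ set $\mathfrak a(\gamma)=\{u\in\mathfrak a\mid [y,u]=\gamma u\}$. Suppose there exists a non-zero $v\in\mathfrak a(1)$. Let $$g^j:\mathfrak a(j)\to F[X]_{ds_{j+1}},\quad u\mapsto g^j_u,\qquad 0\le j<m,$$ be arbitrary linear maps satisfying $g^1_v=1$. Then the map $R:\mathfrak h\to\mathfrak{gl}(U)$ given by $$R(y)=A,$$ $$R(u)=g^j_u(E)\,T^j,\quad u\in\mathfrak a(j),\ 0\le j<m,$$ $$R(u)=0,\quad u\in\mathfrak a(\gamma),\ \gamma\notin\{0,1,\dots,m-1\},$$ defines a representation of $\mathfrak h$ that makes $U$ into a linked $\mathfrak h$-module of nilpotency length $m$. Moreover, $U$ is uniserial if and only if $s_1=\cdots=s_m=1$. Furthermore, suppose that, if $F$ has prime characteristic $p$, then $p\ge m$ and the stabilizer of $p_1$ under the action of the additive group $F^+$ on $F[X]$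 given by $g^{\sigma(\gamma)}(X)=g(X+\gamma)$, $\gamma\in F$, is trivial. Then any modification whatsoever to $m,p_1,s_1,\dots,s_m,g^0,\dots,g^{m-1}$ that keeps $g^1_v=1$ produces an inequivalent representation.
   Context: $F$ is an arbitrary field. All vector spaces, Lie algebras and modules are finite dimensional over $F$ (polynomial algebras excepted). For $n\ge 0$, $F[X]_n=\{a_0+a_1X+\cdots+a_{n-1}X^{n-1}\mid a_i\in F\}$. Operators on $U$: $A$ is multiplication by $X$, i.e. $Au=Xu$ for $u\in U$. $T$ is the $F$-linear operator determined by $Tu_1=0$, $Tu_i=p_{i-1}(X)^{s_{i-1}-s_i}u_{i-1}$ for $2\le i\le m$, and $T\,g(X+1)u=g(X)\,Tu$ for all $g\in F[X]$, $u\in U$. $E$ is the $F[X]$-module endomorphism of $U$ with $Eu_i=(X+(i-1))u_i$ for $1\le i\le m$. For $g\in F[X]$, $g(E)$ denotes $g$ evaluated at $E$. Linked modules: let $\mathfrak g$ be a Lie algebra with solvable radical $\mathfrak r$ and put $\mathfrak n=[\mathfrak g,\mathfrak r]$. A $\mathfrak g$-module $U$ is admissible if it is non-zero and $\mathfrak n$ acts on $U$ via nilpotent operators. The nilpotency series $0=U^{(0)}\subset U^{(1)}\subset\cdots\subset U^{(m)}=U$ of an admissible module is defined, with strict inclusions, so that $U^{(i)}/U^{(i-1)}=\{w\in U/U^{(i-1)}\mid \mathfrak n w=0\}$ for $1\le i\le m$; $m$ is the nilpotency length of $U$ and the quotients $U^{(i)}/U^{(i-1)}$ are its nilpotency factors,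 which are modules over $\mathfrak g/\mathfrak n$. A non-zero module is uniserial if its submodules form a chain. $U$ is linked if it is admissible and all of its nilpotency factors are uniserial as $\mathfrak g/\mathfrak n$-modules.
   Formalization: If F has prime characteristic p < m, then a(j) = a(j+p) and the given formula for R(u) can conflict; there R(u) is taken to be the sum of g^k_u(E)T^k over all k < m with k = j in F. Otherwise the formula is unchanged. *)

theory Defs
  imports
    "HOL-Computational_Algebra.Computational_Algebra"
    "HOL-Library.Set_Algebras"
begin

section \<open>Lie algebras\<close>

locale lie_algebra = vector_space scale
  for scale :: "'f::field \<Rightarrow> 'g::ab_group_add \<Rightarrow> 'g" (infixr "*s" 75) +
  fixes br :: "'g \<Rightarrow> 'g \<Rightarrow> 'g"
  assumes finite_dim: "\<exists>B. finite B \<and> span B = UNIV"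
    and br_add_left: "br (x + y) z = br x z + br y z"
    and br_add_right: "br x (y + z) = br x y + br x z"
    and br_scale_left: "br (c *s x) y = c *s br x y"
    and br_scale_right: "br x (c *s y) = c *s br x y"
    and br_self: "br x x = 0"
    and jacobi: "br x (br y z) + br y (br z x) + br z (br x y) = 0"
begin

definition bracket :: "'g set \<Rightarrow> 'g set \<Rightarrow> 'g set" where
  "bracket I J = span {br x z | x z. x \<in> I \<and> z \<in> J}"

definition lie_ideal :: "'g set \<Rightarrow> bool" where
  "lie_ideal I \<longleftrightarrow> subspace I \<and> (\<forall>x. \<forall>z\<in>I. br x z \<in> I)"

primrec derived_series :: "'g set \<Rightarrow> nat \<Rightarrow> 'g set" where
  "derived_series I 0 = I"
| "derived_series I (Suc k) = bracket (derived_series I k) (derived_series I k)"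

definition solvable_ideal :: "'g set \<Rightarrow> bool" where
  "solvable_ideal I \<longleftrightarrow> lie_ideal I \<and> (\<exists>k. derived_series I k = {0})"

text \<open>The solvable radical, as the sum of all solvable ideals.\<close>

definition radical :: "'g set" where
  "radical = span (\<Union> {I. solvable_ideal I})"

definition nil_ideal :: "'g set" where
  "nil_ideal = bracket UNIV radical"

definition weight_space :: "'g \<Rightarrow> 'g set \<Rightarrow> 'f \<Rightarrow> 'g set" where
  "weight_space y a \<gamma> = {u \<in> a. br y u = \<gamma> *s u}"

text \<open>The whole algebra is the semidirect product of the line through \<open>y\<close> and the abelian
  ideal \<open>a\<close>, and \<open>ad y\<close> is diagonalizable on \<open>a\<close>, i.e. \<open>a\<close> has a basis of eigenvectors.\<close>

definition diag_semidirect :: "'g \<Rightarrow> 'g set \<Rightarrow> bool" where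
  "diag_semidirect y a \<longleftrightarrow>
     y \<noteq> 0 \<and> lie_ideal a \<and> (\<forall>u\<in>a. \<forall>w\<in>a. br u w = 0) \<and>
     span {y} \<inter> a = {0} \<and> (\<forall>x. \<exists>c. \<exists>u\<in>a. x = c *s y + u) \<and>
     (\<exists>B. independent B \<and> span B = a \<and> (\<forall>b\<in>B. \<exists>\<gamma>. b \<in> weight_space y a \<gamma>))"

end

section \<open>Modules and submodules on carrier sets\<close>

text \<open>Only this raw structure is needed to speak of submodules. Carriers are explicit because
  nilpotency factors are sets of cosets, acted upon by cosets of the Lie algebra.\<close>

record ('f, 'g, 'v) lie_act =
  acting :: "'g set"
  mcarrier :: "'v set"
  mzero :: "'v"
  madd :: "'v \<Rightarrow> 'v \<Rightarrow> 'v"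
  mscale :: "'f \<Rightarrow> 'v \<Rightarrow> 'v"
  mact :: "'g \<Rightarrow> 'v \<Rightarrow> 'v"

definition lie_submodule :: "('f, 'g, 'v) lie_act \<Rightarrow> 'v set \<Rightarrow> bool" where
  "lie_submodule M W \<longleftrightarrow>
     W \<subseteq> mcarrier M \<and> mzero M \<in> W \<and>
     (\<forall>v\<in>W. \<forall>w\<in>W. madd M v w \<in> W) \<and>
     (\<forall>c. \<forall>w\<in>W. mscale M c w \<in> W) \<and>
     (\<forall>x\<in>acting M. \<forall>w\<in>W. mact M x w \<in> W)"

definition uniserial :: "('f, 'g, 'v) lie_act \<Rightarrow> bool" where
  "uniserial M \<longleftrightarrow> mcarrier M \<noteq> {mzero M} \<and>
     (\<forall>W1 W2. lie_submodule M W1 \<and> lie_submodule M W2 \<longrightarrow> W1 \<subseteq> W2 \<or> W2 \<subseteq> W1)"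

section \<open>Representations, nilpotency series, linked modules\<close>

locale lie_rep = lie_algebra gscale br + V: vector_space vscale
  for gscale :: "'f::field \<Rightarrow> 'g::ab_group_add \<Rightarrow> 'g"
    and br :: "'g \<Rightarrow> 'g \<Rightarrow> 'g"
    and vscale :: "'f \<Rightarrow> 'v::ab_group_add \<Rightarrow> 'v" +
  fixes act :: "'g \<Rightarrow> 'v \<Rightarrow> 'v"
  assumes V_finite_dim: "\<exists>B. finite B \<and> V.span B = UNIV"
    and act_add_right: "act x (v + w) = act x v + act x w"
    and act_scale_right: "act x (vscale c v) = vscale c (act x v)"
    and act_add_left: "act (x + z) v = act x v + act z v"
    and act_scale_left: "act (gscale c x) v = vscale c (act x v)"
    and act_br: "act (br x z) v = act x (act z v) - act z (act x v)"
begin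

definition self_module :: "('f, 'g, 'v) lie_act" where
  "self_module = \<lparr>acting = UNIV, mcarrier = UNIV, mzero = 0, madd = (+), mscale = vscale, mact = act\<rparr>"

definition admissible :: bool where
  "admissible \<longleftrightarrow> (UNIV :: 'v set) \<noteq> {0} \<and> (\<forall>x\<in>nil_ideal. \<exists>k. \<forall>v. (act x ^^ k) v = 0)"

text \<open>An element \<open>x\<close> annihilates the coset \<open>w +o W\<close> in the quotient by the submodule \<open>W\<close>
  precisely when \<open>act x w \<in> W\<close>.\<close>

primrec nil_series :: "nat \<Rightarrow> 'v set" where
  "nil_series 0 = {0}"
| "nil_series (Suc i) = {w. \<forall>x\<in>nil_ideal. act x w \<in> nil_series i}"

definition nilpotency_length :: "nat \<Rightarrow> bool" where
  "nilpotency_length m \<longleftrightarrow>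
     nil_series m = UNIV \<and> (\<forall>i<m. nil_series i \<subset> nil_series (Suc i))"

text \<open>For submodules \<open>V1 \<subseteq> V2\<close> such that \<open>nil_ideal\<close> maps \<open>V2\<close> into \<open>V1\<close>: the quotient of \<open>V2\<close> by
  \<open>V1\<close> as a module over the quotient of the Lie algebra by \<open>nil_ideal\<close>. Both quotients consist of
  cosets; \<open>+\<close> and \<open>+o\<close> are those of \<open>Set_Algebras\<close>. Adding \<open>V1\<close> in the last two operations
  completes the set of products of representatives to a full coset (e.g. for the scalar 0).\<close>

definition factor_module :: "'v set \<Rightarrow> 'v set \<Rightarrow> ('f, 'g set, 'v set) lie_act" where
  "factor_module V2 V1 =
     \<lparr>acting = range (\<lambda>x. x +o nil_ideal),
      mcarrier = (\<lambda>w. w +o V1) ` V2,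
      mzero = V1,
      madd = (+),
      mscale = (\<lambda>c C. vscale c ` C + V1),
      mact = (\<lambda>X C. {act x w | x w. x \<in> X \<and> w \<in> C} + V1)\<rparr>"

definition linked :: bool where
  "linked \<longleftrightarrow> admissible \<and>
     (\<exists>m. nilpotency_length m \<and>
       (\<forall>i\<in>{1..m}. uniserial (factor_module (nil_series i) (nil_series (i - 1)))))"

end

definition equivalent_reps ::
  "('f::field \<Rightarrow> 'v::ab_group_add \<Rightarrow> 'v) \<Rightarrow> ('g \<Rightarrow> 'v \<Rightarrow> 'v) \<Rightarrow>
   ('f \<Rightarrow> 'w::ab_group_add \<Rightarrow> 'w) \<Rightarrow> ('g \<Rightarrow> 'w \<Rightarrow> 'w) \<Rightarrow> bool" where
  "equivalent_reps vs R ws S \<longleftrightarrow>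
     (\<exists>\<phi>. Vector_Spaces.linear vs ws \<phi> \<and> bij \<phi> \<and> (\<forall>x v. \<phi> (R x v) = S x (\<phi> v)))"

section \<open>The torsion module and its operators\<close>

definition translate_poly :: "'f::field poly \<Rightarrow> 'f \<Rightarrow> 'f poly" where
  "translate_poly g \<gamma> = pcompose g [:\<gamma>, 1:]"

definition pp :: "'f::field poly \<Rightarrow> nat \<Rightarrow> 'f poly" where
  "pp p1 i = translate_poly p1 (of_nat (i - 1))"

definition poly_below :: "nat \<Rightarrow> 'f::field poly set" where
  "poly_below n = {g. \<forall>k\<ge>n. coeff g k = 0}"

definition restrict_scale :: "('f::field poly \<Rightarrow> 'u::ab_group_add \<Rightarrow> 'u) \<Rightarrow> 'f \<Rightarrow> 'u \<Rightarrow> 'u" where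
  "restrict_scale sm c w = sm [:c:] w"

text \<open>The polynomial module \<open>sm\<close> is the internal direct sum of the cyclic submodules generated by
  \<open>u 1, \<dots>, u m\<close>, and the annihilator of \<open>u i\<close> is generated by \<open>pp p1 i ^ s i\<close>. Here and below, \<open>u\<close>
  and \<open>s\<close> matter only on \<open>{1..m}\<close>.\<close>

definition torsion_module ::
  "('f::field poly \<Rightarrow> 'u::ab_group_add \<Rightarrow> 'u) \<Rightarrow> nat \<Rightarrow> 'f poly \<Rightarrow> (nat \<Rightarrow> nat) \<Rightarrow> (nat \<Rightarrow> 'u) \<Rightarrow> bool"
where
  "torsion_module sm m p1 s u \<longleftrightarrow>
     module sm \<and>
     (\<forall>w. \<exists>c. w = (\<Sum>i=1..m. sm (c i) (u i))) \<and>
     (\<forall>c. (\<Sum>i=1..m. sm (c i) (u i)) = 0 \<longrightarrow> (\<forall>i\<in>{1..m}. sm (c i) (u i) = 0)) \<and>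
     (\<forall>i\<in>{1..m}. {f. sm f (u i) = 0} = {f. pp p1 i ^ s i dvd f})"

definition op_A :: "('f::field poly \<Rightarrow> 'u::ab_group_add \<Rightarrow> 'u) \<Rightarrow> 'u \<Rightarrow> 'u" where
  "op_A sm w = sm [:0, 1:] w"

definition op_T ::
  "('f::field poly \<Rightarrow> 'u::ab_group_add \<Rightarrow> 'u) \<Rightarrow> nat \<Rightarrow> 'f poly \<Rightarrow> (nat \<Rightarrow> nat) \<Rightarrow> (nat \<Rightarrow> 'u) \<Rightarrow> 'u \<Rightarrow> 'u"
where
  "op_T sm m p1 s u = (THE T.
     Vector_Spaces.linear (restrict_scale sm) (restrict_scale sm) T \<and>
     T (u 1) = 0 \<and>
     (\<forall>i\<in>{2..m}. T (u i) = sm (pp p1 (i - 1) ^ (s (i - 1) - s i)) (u (i - 1))) \<and>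
     (\<forall>g w. T (sm (translate_poly g 1) w) = sm g (T w)))"

definition op_E ::
  "('f::field poly \<Rightarrow> 'u::ab_group_add \<Rightarrow> 'u) \<Rightarrow> nat \<Rightarrow> (nat \<Rightarrow> 'u) \<Rightarrow> 'u \<Rightarrow> 'u" where
  "op_E sm m u = (THE E. module_hom sm sm E \<and>
     (\<forall>i\<in>{1..m}. E (u i) = sm [:of_nat (i - 1), 1:] (u i)))"

definition poly_of_op ::
  "('f::field \<Rightarrow> 'u::ab_group_add \<Rightarrow> 'u) \<Rightarrow> 'f poly \<Rightarrow> ('u \<Rightarrow> 'u) \<Rightarrow> 'u \<Rightarrow> 'u" where
  "poly_of_op sc g E w = (\<Sum>k\<le>degree g. sc (coeff g k) ((E ^^ k) w))"

section \<open>The representation\<close>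

text \<open>Parameters \<open>m, p1, s\<close> and linear maps \<open>g j\<close> on the weight spaces of weight \<open>j\<close>; the values of
  \<open>g j\<close> outside that weight space, and of \<open>g j\<close> for \<open>j \<ge> m\<close>, are irrelevant.\<close>

definition (in lie_algebra) rep_data ::
  "'g \<Rightarrow> 'g set \<Rightarrow> 'g \<Rightarrow> nat \<Rightarrow> 'f poly \<Rightarrow> (nat \<Rightarrow> nat) \<Rightarrow> (nat \<Rightarrow> 'g \<Rightarrow> 'f poly) \<Rightarrow> bool"
where
  "rep_data y a v m p1 s g \<longleftrightarrow>
     m > 1 \<and> lead_coeff p1 = 1 \<and> irreducible p1 \<and>
     (\<forall>i\<in>{1..m}. s i > 0) \<and> (\<forall>i\<in>{1..<m}. s i \<ge> s (Suc i)) \<and>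
     (\<forall>j<m. \<forall>x\<in>weight_space y a (of_nat j). g j x \<in> poly_below (degree p1 * s (j + 1)) \<and>
        (\<forall>c. g j (c *s x) = smult c (g j x)) \<and>
        (\<forall>z\<in>weight_space y a (of_nat j). g j (x + z) = g j x + g j z)) \<and>
     g 1 v = 1"

text \<open>If the field has characteristic 0 or at least \<open>m\<close>, the weights \<open>0, \<dots>, m - 1\<close> are distinct in
  the field and the sum below has the single term \<open>k = j\<close>, so that \<open>x\<close> of weight \<open>j\<close> acts as
  \<open>g j x\<close> evaluated at \<open>E\<close>, times \<open>T ^^ j\<close>. In smaller characteristic several \<open>j < m\<close> denote the same
  weight, and the corresponding contributions are added.\<close>

definition (in lie_algebra) rep_R ::
  "'g \<Rightarrow> 'g set \<Rightarrow> ('f poly \<Rightarrow> 'u::ab_group_add \<Rightarrow> 'u) \<Rightarrow> nat \<Rightarrow> 'f poly \<Rightarrow> (nat \<Rightarrow> nat) \<Rightarrow>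
   (nat \<Rightarrow> 'u) \<Rightarrow> (nat \<Rightarrow> 'g \<Rightarrow> 'f poly) \<Rightarrow> 'g \<Rightarrow> 'u \<Rightarrow> 'u"
where
  "rep_R y a sm m p1 s u g = (THE R.
     (\<forall>w. Vector_Spaces.linear (*s) (restrict_scale sm) (\<lambda>x. R x w)) \<and>
     R y = op_A sm \<and>
     (\<forall>j<m. \<forall>x\<in>weight_space y a (of_nat j). R x = (\<lambda>w.
        \<Sum>k | k < m \<and> (of_nat k :: 'f) = of_nat j.
          poly_of_op (restrict_scale sm) (g k x) (op_E sm m u) ((op_T sm m p1 s u ^^ k) w))) \<and>
     (\<forall>\<gamma>. \<gamma> \<notin> of_nat ` {..<m} \<longrightarrow> (\<forall>x\<in>weight_space y a \<gamma>. R x = (\<lambda>w. 0))))"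

end

theory Submission
  imports Defs
begin

text \<open>Let \<open>fil i\<close> be the submodule generated by \<open>u 1, \<dots>, u i\<close>. Every element of the Lie algebra
  preserves these submodules and acts on \<open>fil (i + 1) / fil i\<close> as multiplication by a polynomial,
  so commutators map \<open>fil (i + 1)\<close> into \<open>fil i\<close>. The vector \<open>v\<close> is a commutator and acts as \<open>T\<close>, up to
  terms lowering the filtration further, and \<open>T\<close> is injective from each factor to the one below.
  Hence \<open>fil\<close> is the nilpotency series. Its factors are cyclic of prime power annihilator, hence
  uniserial. An equivalence of two such representations commutes with \<open>A\<close>, preserves the series
  and so the annihilators \<open>p_i ^ s_i\<close> of its factors; when the \<open>p_i\<close> are distinct it also preserves
  the primary components \<open>F[X] u_i\<close>, so it commutes with \<open>E\<close> and \<open>T\<close>, and \<open>g j\<close> is recovered from the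
  action on \<open>u (j + 1)\<close>, modulo \<open>p1 ^ s (j + 1)\<close>.\<close>

section \<open>Polynomials over a field\<close>

text \<open>\<open>op_T\<close>, \<open>op_E\<close> and \<open>rep_R\<close> are definite
  descriptions, so each needs existence and uniqueness before anything can be said of it. For
  \<open>T\<close> and \<open>E\<close> both come from one principle: \<open>U\<close> is presented
  by the generators \<open>u i\<close> with the relations \<open>q i\<close>, so a map semilinear
  over a ring endomorphism of \<open>F[X]\<close> may be prescribed on the generators if the
  relations are respected, and is determined there. The powers of \<open>T\<close> are semilinear
  over translations of \<open>X\<close>, which alone gives their commutators with \<open>A\<close>.
  The exponent \<open>s (i - 1) - s i\<close> gives \<open>T (u i)\<close> exactly the translate of
  \<open>q i\<close> as annihilator: divisibility makes \<open>T\<close> exist, equality makes it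
  injective between factors. The characteristic is an obstacle twice. The weights
  \<open>0, ..., m - 1\<close> may coincide in \<open>F\<close>, so everything up to uniseriality is
  proved for sums over all exponents denoting one weight. In the last claim, characteristic at least
  \<open>m\<close> separates the weights and, with the trivial stabilizer, the \<open>p_i\<close>;
  in characteristic 0 both are automatic.\<close>

lemma translate_add: "translate_poly (f + g) c = translate_poly f c + translate_poly g c"
  and translate_mult: "translate_poly (f * g) c = translate_poly f c * translate_poly g c"
  and translate_smult: "translate_poly (smult r f) c = smult r (translate_poly f c)"
  and translate_const: "translate_poly [:r:] c = [:r:]"
  and translate_1: "translate_poly 1 c = 1"
  and translate_X: "translate_poly [:r, 1:] c = [:c + r, 1:]"
  by (simp_all add: translate_poly_def pcompose_add pcompose_mult pcompose_smult
      pcompose_1 pcompose_pCons)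

lemma translate_power: "translate_poly (f ^ n) c = translate_poly f c ^ n"
  by (induction n) (simp_all add: translate_1 translate_mult)

lemma translate_translate: "translate_poly (translate_poly f c) d = translate_poly f (c + d)"
  by (simp add: translate_poly_def pcompose_assoc [symmetric] pcompose_pCons add.commute)

lemma translate_by_0 [simp]: "translate_poly f 0 = f"
  by (simp add: translate_poly_def)

lemma translate_dvd_iff [simp]: "translate_poly f c dvd translate_poly g c \<longleftrightarrow> f dvd g"
proof
  assume "translate_poly f c dvd translate_poly g c"
  then obtain h where "translate_poly g c = translate_poly f c * h" by (elim dvdE)
  then have "translate_poly (translate_poly g c) (-c) =
      translate_poly (translate_poly f c) (-c) * translate_poly h (-c)"
    by (simp add: translate_mult)
  then show "f dvd g" by (simp add: translate_translate)
qed (auto simp: translate_mult)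

lemma degree_translate [simp]: "degree (translate_poly f c) = degree f"
  by (simp add: translate_poly_def degree_pcompose)

lemma lead_coeff_translate: "lead_coeff (translate_poly f c) = lead_coeff f"
  using lead_coeff_comp [of "[:c, 1:]" f] by (simp add: translate_poly_def)

lemma irreducible_translate:
  fixes f :: "'f::field poly"
  assumes "irreducible f"
  shows "irreducible (translate_poly f c)"
proof (rule irreducibleI)
  show "translate_poly f c \<noteq> 0"
    using assms lead_coeff_translate [of f c] by (auto simp: irreducible_def)
  show "\<not> translate_poly f c dvd 1"
    using assms translate_dvd_iff [of f c 1] by (simp add: irreducible_def translate_1)
  fix a b assume "translate_poly f c = a * b"
  then have "translate_poly (translate_poly f c) (-c) = translate_poly a (-c) * translate_poly b (-c)"
    by (simp add: translate_mult)
  then have "translate_poly a (-c) dvd 1 \<or> translate_poly b (-c) dvd 1"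
    using assms by (auto simp: translate_translate irreducible_def)
  then show "a dvd 1 \<or> b dvd 1"
    using translate_dvd_iff [of a "-c" 1] translate_dvd_iff [of b "-c" 1] by (simp add: translate_1)
qed

lemma of_nat_inj_below_char:
  assumes "CHAR('f::ring_1) \<noteq> 0 \<longrightarrow> m \<le> CHAR('f)" and "i < m" and "k < m" and "(of_nat i :: 'f) = of_nat k"
  shows "i = k"
proof -
  have "i = k" if "i \<le> k" "(of_nat i :: 'f) = of_nat k" "k < m" for i k
  proof -
    have "(of_nat (k - i) :: 'f) = 0" using that by (simp add: of_nat_diff)
    then have "CHAR('f) dvd k - i" by (simp add: of_nat_eq_0_iff_char_dvd)
    then show ?thesis using assms(1) that by (cases "CHAR('f) = 0") (auto dest: dvd_imp_le)
  qed
  then show ?thesis using assms by (metis nat_le_linear)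
qed

text \<open>Invariance under translation by \<open>c\<close> makes \<open>f\<close> take the same
  value at all multiples of \<open>c\<close>. In characteristic 0 these are infinitely many, which a
  non-constant polynomial does not allow. Hence the stabilizer hypothesis has to be made in prime
  characteristic only.\<close>

lemma translate_fixed_char_0:
  fixes f :: "'f::field poly"
  assumes "translate_poly f c = f" and "CHAR('f) = 0" and "degree f > 0"
  shows "c = 0"
proof (rule ccontr)
  assume "c \<noteq> 0"
  have step: "poly f (x + c) = poly f x" for x
    using arg_cong [OF assms(1), of "\<lambda>h. poly h x"]
    by (simp add: translate_poly_def poly_pcompose add.commute)
  have "poly f (of_nat n * c) = poly f 0" for n
    by (induction n) (use step in \<open>simp_all add: algebra_simps, metis add.commute\<close>)
  then have "range (\<lambda>n. of_nat n * c) \<subseteq> {x. poly (f - [:poly f 0:]) x = 0}"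
    by auto
  moreover have "inj (\<lambda>n. of_nat n * c)"
  proof (rule injI)
    fix i k assume "of_nat i * c = of_nat k * c"
    then have "(of_nat i :: 'f) = of_nat k" using \<open>c \<noteq> 0\<close> by simp
    then show "i = k"
      using assms(2) of_nat_inj_below_char [where ?'f = 'f and m = "Suc (i + k)"] by simp
  qed
  then have "infinite (range (\<lambda>n. of_nat n * c))"
    by (rule range_inj_infinite)
  ultimately have "f - [:poly f 0:] = 0"
    using poly_roots_finite infinite_super by blast
  then show False
    using assms(3) by (metis degree_pCons_0 eq_iff_diff_eq_0 less_irrefl)
qed

lemma pcompose_as_sum: "pcompose f h = (\<Sum>k\<le>degree f. smult (coeff f k) (h ^ k))"
  unfolding pcompose_altdef poly_altdef
  by (simp add: degree_map_poly coeff_map_poly)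

section \<open>Bezout relations, and ideals containing a power of an irreducible polynomial\<close>

lemma irreducible_bezout:
  fixes p :: "'f::field poly"
  assumes p: "irreducible p" and f: "\<not> p dvd f"
  shows "\<exists>a b. a * p + b * f = 1"
proof -
  \<comment> \<open>An element \<open>d\<close> of least degree among the non-zero combinations
    divides all of them, by division with remainder. As \<open>p\<close> is irreducible,
    \<open>d\<close> is a unit or an associate of \<open>p\<close>; the latter is excluded since
    \<open>d\<close> divides \<open>f\<close>.\<close>
  define I where "I = {h. h \<noteq> 0 \<and> (\<exists>a b. h = a * p + b * f)}"
  have "p \<noteq> 0" using p by (auto simp: irreducible_def)
  moreover have "p = 1 * p + 0 * f" by simp
  ultimately have "p \<in> I" unfolding I_def by blast
  then obtain d where d: "d \<in> I" and min: "\<And>h. h \<in> I \<Longrightarrow> degree d \<le> degree h"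
    using ex_has_least_nat [of "\<lambda>h. h \<in> I" p degree] by blast
  then obtain a b where ab: "d = a * p + b * f" and "d \<noteq> 0" unfolding I_def by blast
  have dvd: "d dvd x" if "x = a' * p + b' * f" for x a' b'
  proof (rule ccontr)
    assume "\<not> d dvd x"
    then have nz: "x mod d \<noteq> 0" by (simp add: dvd_eq_mod_eq_0)
    have "x mod d = x - x div d * d" by (simp add: minus_div_mult_eq_mod)
    also have "\<dots> = (a' - x div d * a) * p + (b' - x div d * b) * f"
      by (simp only: that ab algebra_simps)
    finally have "x mod d \<in> I" using nz unfolding I_def by blast
    then have "degree d \<le> degree (x mod d)" by (rule min)
    then show False using degree_mod_less' [OF \<open>d \<noteq> 0\<close> nz] by simp
  qed
  have "d dvd p" using dvd [of p 1 0] by simp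
  then obtain e where e: "p = d * e" by (elim dvdE)
  have "d dvd f" using dvd [of f 0 1] by simp
  have "\<not> e dvd 1"
  proof
    assume "e dvd 1"
    then have "p dvd d" using e by (metis dvd_refl mult_unit_dvd_iff)
    then show False using f \<open>d dvd f\<close> dvd_trans by blast
  qed
  then have "d dvd 1" using e p by (auto simp: irreducible_def)
  then obtain c where c: "1 = d * c" by (elim dvdE)
  have "c * a * p + c * b * f = 1" unfolding c ab by (simp add: algebra_simps)
  then show ?thesis by blast
qed

lemma irreducible_power_bezout:
  fixes p :: "'f::field poly"
  assumes "irreducible p" and "\<not> p dvd f"
  shows "\<exists>a b. a * p ^ n + b * f = 1"
proof (induction n)
  case 0
  show ?case by (rule exI [of _ 1], rule exI [of _ 0]) simp
next
  case (Suc n)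
  then obtain a b where ab: "a * p ^ n + b * f = 1" by blast
  obtain c d where cd: "c * p + d * f = 1" using irreducible_bezout [OF assms] by blast
  \<comment> \<open>In the product of the relations for \<open>p ^ n\<close> and for
    \<open>p\<close>, the only term without a factor \<open>f\<close> is the one with
    \<open>p ^ Suc n\<close>.\<close>
  have "1 = (a * p ^ n + b * f) * (c * p + d * f)" by (simp add: ab cd)
  also have "\<dots> = (a * c) * p ^ Suc n + (a * p ^ n * d + b * c * p + b * d * f) * f"
    by (simp add: algebra_simps)
  finally show ?case by metis
qed

lemma irreducible_dvd_power:
  fixes p f :: "'f::field poly"
  shows "irreducible p \<Longrightarrow> p dvd f ^ n \<Longrightarrow> p dvd f"
  by (rule prime_elem_dvd_power [OF field_poly_irreducible_imp_prime])

lemma monic_dvd_eq: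
  fixes f h :: "'f::field poly"
  assumes "f dvd h" and "h dvd f" and "lead_coeff f = 1" and "lead_coeff h = 1"
  shows "f = h"
proof -
  obtain k where k: "h = f * k" using assms(1) by (elim dvdE)
  have nz: "f \<noteq> 0" "h \<noteq> 0" using assms(3,4) by auto
  have "degree f = degree h"
    using assms(1,2) nz by (meson dvd_imp_degree_le le_antisym)
  with k nz have "degree k = 0" by (metis add_left_cancel add.right_neutral degree_mult_eq mult_zero_right)
  then obtain r where r: "k = [:r:]" by (elim degree_eq_zeroE)
  have "lead_coeff k = 1" using k assms(3,4) by (simp add: lead_coeff_mult)
  then show ?thesis using k r by (simp add: one_pCons [symmetric])
qed

lemma monic_irreducible_dvd_eq:
  fixes p r :: "'f::field poly"
  assumes "irreducible p" and "irreducible r" and "p dvd r" and "lead_coeff p = 1" and "lead_coeff r = 1"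
  shows "p = r"
proof -
  obtain k where k: "r = p * k" using assms(3) by (elim dvdE)
  then have "k dvd 1" using assms(1,2) by (auto simp: irreducible_def)
  then have "r dvd p" unfolding k by (simp add: mult_unit_dvd_iff)
  then show ?thesis using assms monic_dvd_eq by blast
qed

text \<open>\<open>F[X]/(p ^ n)\<close> is a chain ring: with \<open>f\<close>, an ideal containing
  \<open>p ^ n\<close> also contains a power of \<open>p\<close> that divides \<open>f\<close>, by a
  Bezout relation for the cofactor. Two ideals are then compared through exponents. This is the
  source of uniseriality of the nilpotency factors.\<close>

lemma poly_ideal_chain:
  fixes p :: "'f::field poly"
  assumes p: "irreducible p"
    and I: "\<And>f h. f \<in> I \<Longrightarrow> h \<in> I \<Longrightarrow> f + h \<in> I" "\<And>f h. f \<in> I \<Longrightarrow> h * f \<in> I" "p ^ n \<in> I"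
    and J: "\<And>f h. f \<in> J \<Longrightarrow> h \<in> J \<Longrightarrow> f + h \<in> J" "\<And>f h. f \<in> J \<Longrightarrow> h * f \<in> J" "p ^ n \<in> J"
  shows "I \<subseteq> J \<or> J \<subseteq> I"
proof (rule ccontr)
  have power_in: "\<exists>k. p ^ k dvd f \<and> p ^ k \<in> K"
    if K: "\<And>f h. f \<in> K \<Longrightarrow> h \<in> K \<Longrightarrow> f + h \<in> K" "\<And>f h. f \<in> K \<Longrightarrow> h * f \<in> K" "p ^ n \<in> K"
      and f: "f \<in> K" for K f
  \<comment> \<open>If \<open>p ^ n\<close> divides \<open>f\<close>, a greatest power dividing
    \<open>f\<close> need not exist (\<open>f\<close> may be 0), and \<open>p ^ n\<close> itself
    serves. Otherwise \<open>n\<close> bounds the exponents.\<close>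
  proof (cases "p ^ n dvd f")
    case True
    then show ?thesis using K(3) by blast
  next
    case False
    define k where "k = (GREATEST k. p ^ k dvd f)"
    have bd: "p ^ k dvd f \<Longrightarrow> k \<le> n" for k
      using False by (metis dvd_trans le_imp_power_dvd nat_le_linear)
    have k: "p ^ k dvd f" unfolding k_def
      by (rule GreatestI_nat [of "\<lambda>k. p ^ k dvd f" 0]) (auto intro: bd)
    then obtain f' where f': "f = p ^ k * f'" by (elim dvdE)
    have "\<not> p dvd f'"
    proof
      assume "p dvd f'"
      then have "p ^ Suc k dvd f" unfolding f' by (metis dvd_refl mult_dvd_mono power_Suc2)
      then have "Suc k \<le> k" unfolding k_def
        by (intro Greatest_le_nat [of "\<lambda>k. p ^ k dvd f"]) (auto intro: bd)
      then show False by simp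
    qed
    then obtain a b where ab: "a * p ^ n + b * f' = 1"
      using irreducible_power_bezout [OF p] by blast
    have "p ^ k = p ^ k * (a * p ^ n + b * f')" by (simp add: ab)
    also have "\<dots> = (p ^ k * a) * p ^ n + b * f" by (simp add: f' algebra_simps)
    also have "\<dots> \<in> K" using K f by blast
    finally show ?thesis using k by blast
  qed
  assume "\<not> (I \<subseteq> J \<or> J \<subseteq> I)"
  then obtain f h where fh: "f \<in> I" "f \<notin> J" "h \<in> J" "h \<notin> I" by blast
  obtain k where k: "p ^ k dvd f" "p ^ k \<in> I" using power_in [of I f] I fh by blast
  obtain l where l: "p ^ l dvd h" "p ^ l \<in> J" using power_in [of J h] J fh by blast
  show False
  proof (cases "k \<le> l")
    case True
    then have "p ^ k dvd h" using l(1) by (meson dvd_trans le_imp_power_dvd)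
    then show False using k(2) I(2) fh by (metis dvd_def mult.commute)
  next
    case False
    then have "p ^ l dvd f" using k(1) by (meson dvd_trans le_imp_power_dvd nat_le_linear)
    then show False using l(2) J(2) fh by (metis dvd_def mult.commute)
  qed
qed

section \<open>The torsion module and its operators\<close>

lemma lead_coeff_pp: "lead_coeff (pp p i) = lead_coeff p"
  and irreducible_pp: "irreducible p \<Longrightarrow> irreducible (pp p i)"
  and pp_1 [simp]: "pp p (Suc 0) = p"
  using lead_coeff_translate [of p "of_nat (i - 1)"]
  by (simp_all add: pp_def irreducible_translate)

lemma degree_pp [simp]: "degree (pp p i) = degree p"
  by (simp add: pp_def)

lemma degree_monic_power:
  fixes p :: "'f::field poly"
  shows "lead_coeff p = 1 \<Longrightarrow> degree (p ^ n) = n * degree p"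
  by (metis degree_power_eq leading_coeff_0_iff zero_neq_one)

text \<open>The assumption keeps \<open>i - k\<close> at least 1, so that none of the subtractions
  of natural numbers is truncated. With \<open>k = 1\<close> this is the match between
  \<open>p_i\<close> and \<open>p_(i-1)\<close> on which \<open>T\<close> rests.\<close>

lemma translate_pp:
  assumes "k < i"
  shows "translate_poly (pp p i) (- of_nat k) = pp p (i - k)"
proof -
  have "i - 1 = (i - k - 1) + k" using assms by simp
  then have "(of_nat (i - 1) :: 'a) = of_nat (i - k - 1) + of_nat k" by (metis of_nat_add)
  then show ?thesis by (simp add: pp_def translate_translate)
qed

text \<open>One notion for all operators: \<open>\<tau>\<close> is the identity for \<open>E\<close>
  and polynomials in \<open>E\<close>, and translation by \<open>-k\<close> for
  \<open>T ^^ k\<close>. That \<open>\<tau>\<close> respects sums and products is demanded only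
  where maps are constructed.\<close>

definition semilinear ::
  "('f::field poly \<Rightarrow> 'u::ab_group_add \<Rightarrow> 'u) \<Rightarrow> ('f poly \<Rightarrow> 'f poly) \<Rightarrow> ('u \<Rightarrow> 'u) \<Rightarrow> bool" where
  "semilinear sm \<tau> D \<longleftrightarrow> (\<forall>v w. D (v + w) = D v + D w) \<and> (\<forall>f w. D (sm f w) = sm (\<tau> f) (D w))"

locale torsion =
  fixes sm :: "'f::field poly \<Rightarrow> 'u::ab_group_add \<Rightarrow> 'u"
    and m :: nat and p1 :: "'f poly" and s :: "nat \<Rightarrow> nat" and u :: "nat \<Rightarrow> 'u"
  assumes torsion_module: "torsion_module sm m p1 s u"
    and m_gt_1: "m > 1" and monic: "lead_coeff p1 = 1" and irred: "irreducible p1"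
    and s_pos: "i \<in> {1..m} \<Longrightarrow> s i > 0"
    and s_antimono_step: "i \<in> {1..<m} \<Longrightarrow> s i \<ge> s (Suc i)"
begin

sublocale module sm
  using torsion_module by (simp add: torsion_module_def)

sublocale V: vector_space "restrict_scale sm"
  by unfold_locales
     (simp_all add: restrict_scale_def scale_right_distrib scale_left_distrib [symmetric]
       one_pCons [symmetric] mult.commute)

abbreviation q :: "nat \<Rightarrow> 'f poly" where
  "q i \<equiv> pp p1 i ^ s i"

lemma s_antimono: "1 \<le> i \<Longrightarrow> i \<le> k \<Longrightarrow> k \<le> m \<Longrightarrow> s k \<le> s i"
proof (induction k)
  case (Suc k)
  then show ?case using s_antimono_step [of k] by (cases "i = Suc k") force+
qed auto

lemma coordinates: "\<exists>c. w = (\<Sum>i=1..m. sm (c i) (u i))"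
  using torsion_module unfolding torsion_module_def by blast

lemma coordinates_0: "(\<Sum>i=1..m. sm (c i) (u i)) = 0 \<Longrightarrow> i \<in> {1..m} \<Longrightarrow> sm (c i) (u i) = 0"
  using torsion_module unfolding torsion_module_def by blast

lemma annihilator: "i \<in> {1..m} \<Longrightarrow> sm f (u i) = 0 \<longleftrightarrow> q i dvd f"
  using torsion_module unfolding torsion_module_def by blast

lemma coordinates_unique:
  assumes "(\<Sum>i=1..m. sm (c i) (u i)) = (\<Sum>i=1..m. sm (d i) (u i))" and "i \<in> {1..m}"
  shows "q i dvd c i - d i"
proof -
  have "(\<Sum>i=1..m. sm (c i - d i) (u i)) = 0"
    using assms(1) by (simp add: scale_left_diff_distrib sum_subtractf)
  then show ?thesis using coordinates_0 [where c = "\<lambda>i. c i - d i"] annihilator assms(2) by blast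
qed

lemma p1_not_unit: "\<not> p1 dvd 1" "\<not> pp p1 i dvd 1"
  using irred irreducible_pp [OF irred, of i] by (auto simp: irreducible_def)

lemma pp_nz: "pp p1 i \<noteq> 0"
  using irreducible_pp [OF irred, of i] by (auto simp: irreducible_def)

lemma degree_p1: "degree p1 > 0"
proof (rule ccontr)
  assume "\<not> degree p1 > 0"
  then obtain c where "p1 = [:c:]" by (auto elim: degree_eq_zeroE)
  with monic have "p1 = 1" by (simp add: one_pCons)
  then show False using p1_not_unit by simp
qed

lemma u_nz: "i \<in> {1..m} \<Longrightarrow> u i \<noteq> 0"
  using annihilator [of i 1] s_pos [of i] p1_not_unit(2) [of i]
  by (auto simp: dvd_power_iff is_unit_power_iff)

section \<open>Semilinear maps and their values on the generators\<close>

lemma semilinear_0: "semilinear sm \<tau> D \<Longrightarrow> D 0 = 0"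
  by (metis add_cancel_right_right semilinear_def)

lemma semilinear_diff: "semilinear sm \<tau> D \<Longrightarrow> D (v - w) = D v - D w"
  by (metis add_diff_cancel diff_add_cancel semilinear_def)

lemma semilinear_sum: "semilinear sm \<tau> D \<Longrightarrow> D (sum f I) = (\<Sum>i\<in>I. D (f i))"
  by (induction I rule: infinite_finite_induct) (simp_all add: semilinear_0, simp add: semilinear_def)

text \<open>This reduces every operator identity below, such as the commutation of \<open>E\<close>
  with \<open>T\<close>, to a computation on the generators.\<close>

lemma semilinear_eqI:
  assumes D: "semilinear sm \<tau> D" and D': "semilinear sm \<tau> D'"
    and eq: "\<And>i. i \<in> {1..m} \<Longrightarrow> D (u i) = D' (u i)"
  shows "D = D'"
proof
  fix w
  obtain c where c: "w = (\<Sum>i=1..m. sm (c i) (u i))" using coordinates by blast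
  have "D (sm (c i) (u i)) = D' (sm (c i) (u i))" if "i \<in> {1..m}" for i
    using D D' eq [OF that] by (simp add: semilinear_def)
  then show "D w = D' w"
    unfolding c semilinear_sum [OF D] semilinear_sum [OF D'] by (intro sum.cong) auto
qed

lemma semilinear_comp:
  "semilinear sm \<tau> D \<Longrightarrow> semilinear sm \<sigma> D' \<Longrightarrow> semilinear sm (\<lambda>f. \<tau> (\<sigma> f)) (\<lambda>w. D (D' w))"
  by (simp add: semilinear_def)

text \<open>Coordinates are unique only modulo \<open>q i\<close>. Since \<open>\<tau>\<close> is
  multiplicative and \<open>\<tau> (q i)\<close> kills \<open>t i\<close>, so does the image of
  every multiple of \<open>q i\<close>, and the prescription descends to \<open>U\<close>.\<close>

lemma semilinear_exists:
  assumes \<tau>: "\<And>f h. \<tau> (f + h) = \<tau> f + \<tau> h" "\<And>f h. \<tau> (f * h) = \<tau> f * \<tau> h" "\<tau> 1 = 1"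
    and t: "\<And>i. i \<in> {1..m} \<Longrightarrow> sm (\<tau> (q i)) (t i) = 0"
  shows "\<exists>D. semilinear sm \<tau> D \<and> (\<forall>i\<in>{1..m}. D (u i) = t i)"
proof -
  \<comment> \<open>An arbitrary choice of coordinates; the fact \<open>D\<close> below shows that
    the result does not depend on it, and additivity and semilinearity follow from that.\<close>
  define crd where "crd w = (SOME c. w = (\<Sum>i=1..m. sm (c i) (u i)))" for w
  define D where "D w = (\<Sum>i=1..m. sm (\<tau> (crd w i)) (t i))" for w
  have \<tau>0: "\<tau> 0 = 0" using \<tau>(1) [of 0 0] by (metis add_cancel_right_right)
  have D: "D (\<Sum>i=1..m. sm (c i) (u i)) = (\<Sum>i=1..m. sm (\<tau> (c i)) (t i))" for c
  proof -
    define w where "w = (\<Sum>i=1..m. sm (c i) (u i))"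
    have "w = (\<Sum>i=1..m. sm (crd w i) (u i))"
      unfolding crd_def using someI_ex [OF coordinates [of w]] .
    then have dvd: "q i dvd crd w i - c i" if "i \<in> {1..m}" for i
      using coordinates_unique [of "crd w" c] that by (simp add: w_def)
    have "sm (\<tau> (crd w i)) (t i) = sm (\<tau> (c i)) (t i)" if i: "i \<in> {1..m}" for i
    proof -
      obtain e where "crd w i - c i = q i * e" using dvd [OF i] by (elim dvdE)
      then have "crd w i = c i + e * q i" by (simp add: algebra_simps)
      then have "sm (\<tau> (crd w i)) (t i) = sm (\<tau> (c i)) (t i) + sm (\<tau> e) (sm (\<tau> (q i)) (t i))"
        by (simp only: \<tau> scale_left_distrib scale_scale)
      then show ?thesis using t [OF i] by simp
    qed
    then show ?thesis unfolding w_def [symmetric] D_def by (intro sum.cong) auto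
  qed
  have "semilinear sm \<tau> D"
    unfolding semilinear_def
  proof (intro conjI allI)
    fix v w f
    obtain c where c: "v = (\<Sum>i=1..m. sm (c i) (u i))" using coordinates by blast
    obtain d where d: "w = (\<Sum>i=1..m. sm (d i) (u i))" using coordinates by blast
    have "v + w = (\<Sum>i=1..m. sm (c i + d i) (u i))"
      by (simp add: c d scale_left_distrib sum.distrib)
    then show "D (v + w) = D v + D w"
      by (simp only: c d D \<tau>) (simp add: scale_left_distrib sum.distrib)
    have "sm f w = (\<Sum>i=1..m. sm (f * d i) (u i))"
      by (simp add: d scale_sum_right)
    then show "D (sm f w) = sm (\<tau> f) (D w)"
      by (simp only: d D \<tau>) (simp add: scale_sum_right)
  qed
  moreover have "D (u i) = t i" if "i \<in> {1..m}" for i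
  proof -
    have "u i = (\<Sum>k=1..m. sm (if k = i then 1 else 0) (u k))"
      using that by (simp add: if_distrib [of "\<lambda>f. sm f _"] cong: if_cong)
    then have "D (u i) = (\<Sum>k=1..m. sm (\<tau> (if k = i then 1 else 0)) (t k))"
      using D by metis
    also have "\<dots> = (\<Sum>k=1..m. if k = i then t k else 0)"
      by (intro sum.cong) (simp_all add: \<tau> \<tau>0)
    also have "\<dots> = t i" using that by simp
    finally show ?thesis .
  qed
  ultimately show ?thesis by blast
qed

subsection \<open>The filtration\<close>

definition fil :: "nat \<Rightarrow> 'u set" where
  "fil i = {(\<Sum>k=1..i. sm (c k) (u k)) | c. True}"

lemma sum_in_fil: "(\<Sum>k=1..i. sm (c k) (u k)) \<in> fil i"
  unfolding fil_def by blast

lemma fil_0: "fil 0 = {0}"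
  by (simp add: fil_def)

lemma fil_m: "fil m = UNIV"
  using coordinates by (auto simp: fil_def)

lemma fil_add: "v \<in> fil i \<Longrightarrow> w \<in> fil i \<Longrightarrow> v + w \<in> fil i"
  unfolding fil_def by (force simp: sum.distrib [symmetric] scale_left_distrib [symmetric])

lemma fil_scale: "w \<in> fil i \<Longrightarrow> sm f w \<in> fil i"
  unfolding fil_def by (force simp: scale_sum_right)

lemma zero_in_fil: "0 \<in> fil i"
  unfolding fil_def by (auto intro!: exI [of _ "\<lambda>_. 0"])

lemma fil_minus: "w \<in> fil i \<Longrightarrow> - w \<in> fil i"
  by (metis fil_scale scale_minus_left scale_one)

lemma fil_diff: "v \<in> fil i \<Longrightarrow> w \<in> fil i \<Longrightarrow> v - w \<in> fil i"
  by (metis fil_add fil_minus add_uminus_conv_diff)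

lemma fil_sum: "(\<And>x. x \<in> I \<Longrightarrow> f x \<in> fil i) \<Longrightarrow> sum f I \<in> fil i"
  by (induction I rule: infinite_finite_induct) (auto simp: zero_in_fil intro: fil_add)

lemma fil_add_cancel: "w \<in> fil i \<Longrightarrow> v + w \<in> fil i \<longleftrightarrow> v \<in> fil i"
  by (metis add_diff_cancel_right' fil_add fil_diff)

lemma fil_Suc_cases:
  assumes "w \<in> fil (Suc i)"
  obtains h w' where "w = sm h (u (Suc i)) + w'" and "w' \<in> fil i"
proof -
  obtain c where "w = (\<Sum>k=1..Suc i. sm (c k) (u k))" using assms unfolding fil_def by blast
  then have "w = sm (c (Suc i)) (u (Suc i)) + (\<Sum>k=1..i. sm (c k) (u k))" by (simp add: add.commute)
  then show ?thesis using that sum_in_fil by blast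
qed

lemma fil_mono: "i \<le> k \<Longrightarrow> fil i \<subseteq> fil k"
proof (induction rule: dec_induct)
  case (step n)
  have "fil n \<subseteq> fil (Suc n)"
  proof
    fix w assume "w \<in> fil n"
    then obtain c where c: "w = (\<Sum>k=1..n. sm (c k) (u k))" unfolding fil_def by blast
    have "w = (\<Sum>k=1..Suc n. sm (if k \<le> n then c k else 0) (u k))"
      unfolding c by simp
    then show "w \<in> fil (Suc n)" by (simp only: sum_in_fil)
  qed
  with step show ?case by blast
qed simp

lemma generator_in_fil: "1 \<le> k \<Longrightarrow> k \<le> i \<Longrightarrow> sm f (u k) \<in> fil i"
proof -
  assume "1 \<le> k" "k \<le> i"
  have "(\<Sum>j=1..k. sm (if j = k then f else 0) (u j)) = sm f (u k)"
    using \<open>1 \<le> k\<close> by (simp add: if_distrib [of "\<lambda>f. sm f _"] cong: if_cong)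
  then have "sm f (u k) \<in> fil k" by (metis sum_in_fil)
  then show ?thesis using fil_mono \<open>k \<le> i\<close> by blast
qed

text \<open>Directness of the sum identifies \<open>fil (Suc i) / fil i\<close> with
  \<open>F[X]/(q (Suc i))\<close>, generated by the class of \<open>u (Suc i)\<close>.\<close>

lemma generator_in_fil_iff:
  assumes "Suc i \<le> m"
  shows "sm f (u (Suc i)) \<in> fil i \<longleftrightarrow> q (Suc i) dvd f"
proof
  assume "sm f (u (Suc i)) \<in> fil i"
  then obtain c where c: "sm f (u (Suc i)) = (\<Sum>k=1..i. sm (c k) (u k))" unfolding fil_def by blast
  \<comment> \<open>The relation with all terms on one side, padded with zeros up to
    \<open>m\<close>, because independence is known for full sums only.\<close>
  define d where "d k = (if k \<le> i then c k else if k = Suc i then - f else 0)" for k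
  have "(\<Sum>k=1..m. sm (d k) (u k)) = (\<Sum>k=1..Suc i. sm (d k) (u k))"
    using assms by (intro sum.mono_neutral_right) (auto simp: d_def)
  also have "\<dots> = (\<Sum>k=1..i. sm (d k) (u k)) + sm (d (Suc i)) (u (Suc i))" by simp
  also have "(\<Sum>k=1..i. sm (d k) (u k)) = (\<Sum>k=1..i. sm (c k) (u k))"
    by (intro sum.cong) (auto simp: d_def)
  also have "\<dots> + sm (d (Suc i)) (u (Suc i)) = 0"
    unfolding c [symmetric] by (simp add: d_def)
  finally have "sm (d (Suc i)) (u (Suc i)) = 0" using coordinates_0 assms by force
  then show "q (Suc i) dvd f" using annihilator [of "Suc i" f] assms by (simp add: d_def)
next
  assume "q (Suc i) dvd f"
  then have "sm f (u (Suc i)) = 0" using annihilator [of "Suc i" f] assms by simp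
  then show "sm f (u (Suc i)) \<in> fil i" by (simp add: zero_in_fil)
qed

lemma fil_strict: "Suc i \<le> m \<Longrightarrow> fil i \<subset> fil (Suc i)"
proof
  assume "Suc i \<le> m"
  then have "u (Suc i) \<notin> fil i"
    using generator_in_fil_iff [of i 1] s_pos [of "Suc i"] p1_not_unit(2) [of "Suc i"]
    by (auto simp: is_unit_power_iff)
  moreover have "u (Suc i) \<in> fil (Suc i)"
    using generator_in_fil [of "Suc i" "Suc i" 1] by simp
  ultimately show "fil i \<noteq> fil (Suc i)" by blast
qed (simp add: fil_mono)

text \<open>The ideal of \<open>q (Suc i)\<close> is characterized by the filtration alone, without
  the generators, so it can be carried along an equivalence of representations.\<close>

lemma fil_annihilator:
  assumes "Suc i \<le> m"
  shows "(\<forall>w\<in>fil (Suc i). sm f w \<in> fil i) \<longleftrightarrow> q (Suc i) dvd f"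
proof
  assume "\<forall>w\<in>fil (Suc i). sm f w \<in> fil i"
  moreover have "u (Suc i) \<in> fil (Suc i)" using generator_in_fil [of "Suc i" "Suc i" 1] by simp
  ultimately show "q (Suc i) dvd f" using generator_in_fil_iff [OF assms] by blast
next
  assume f: "q (Suc i) dvd f"
  show "\<forall>w\<in>fil (Suc i). sm f w \<in> fil i"
  proof
    fix w assume "w \<in> fil (Suc i)"
    then obtain h w' where w: "w = sm h (u (Suc i)) + w'" "w' \<in> fil i" by (rule fil_Suc_cases)
    have "sm f w = sm (h * f) (u (Suc i)) + sm f w'" by (simp add: w scale_right_distrib mult.commute)
    moreover have "sm (h * f) (u (Suc i)) \<in> fil i"
      using generator_in_fil_iff [OF assms] f by simp
    ultimately show "sm f w \<in> fil i" using w(2) by (simp add: fil_add fil_scale)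
  qed
qed

lemma semilinear_fil:
  assumes D: "semilinear sm \<tau> D" and u: "\<And>k. 1 \<le> k \<Longrightarrow> k \<le> i \<Longrightarrow> D (u k) \<in> fil j"
    and w: "w \<in> fil i"
  shows "D w \<in> fil j"
proof -
  obtain c where c: "w = (\<Sum>k=1..i. sm (c k) (u k))" using w unfolding fil_def by blast
  have "D w = (\<Sum>k=1..i. sm (\<tau> (c k)) (D (u k)))"
    unfolding c semilinear_sum [OF D] using D by (simp add: semilinear_def)
  also have "\<dots> \<in> fil j" by (rule fil_sum, rule fil_scale, rule u) auto
  finally show ?thesis .
qed

subsection \<open>The operators\<close>

abbreviation A where "A \<equiv> op_A sm"
abbreviation T where "T \<equiv> op_T sm m p1 s u"
abbreviation E where "E \<equiv> op_E sm m u"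
abbreviation at_E where "at_E g \<equiv> poly_of_op (restrict_scale sm) g E"
abbreviation down where "down k f \<equiv> translate_poly f (- of_nat k)"

text \<open>The rule for \<open>T (g(X+1) w)\<close> is semilinearity over translation by -1, so the
  description falls under the principle for prescribed values on generators.\<close>

lemma T_ex1: "\<exists>!T. Vector_Spaces.linear (restrict_scale sm) (restrict_scale sm) T \<and> T (u 1) = 0 \<and>
     (\<forall>i\<in>{2..m}. T (u i) = sm (pp p1 (i - 1) ^ (s (i - 1) - s i)) (u (i - 1))) \<and>
     (\<forall>g w. T (sm (translate_poly g 1) w) = sm g (T w))" (is "\<exists>!T. ?P T")
proof -
  define t where "t i = (if i = 1 then 0 else sm (pp p1 (i - 1) ^ (s (i - 1) - s i)) (u (i - 1)))" for i
  have P_iff: "?P D \<longleftrightarrow> semilinear sm (down 1) D \<and> (\<forall>i\<in>{1..m}. D (u i) = t i)" for D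
  proof
    assume P: "?P D"
    then have "D (v + w) = D v + D w" for v w by (simp add: Vector_Spaces.linear_iff)
    moreover have "D (sm f w) = sm (down 1 f) (D w)" for f w
    proof -
      have "D (sm (translate_poly (down 1 f) 1) w) = sm (down 1 f) (D w)" using P by blast
      then show ?thesis by (simp add: translate_translate)
    qed
    ultimately show "semilinear sm (down 1) D \<and> (\<forall>i\<in>{1..m}. D (u i) = t i)"
      using P by (auto simp: semilinear_def t_def)
  next
    assume D: "semilinear sm (down 1) D \<and> (\<forall>i\<in>{1..m}. D (u i) = t i)"
    have "Vector_Spaces.linear (restrict_scale sm) (restrict_scale sm) D"
      using D V.vector_space_axioms
      by (simp add: Vector_Spaces.linear_iff semilinear_def restrict_scale_def translate_const)
    moreover have "D (sm (translate_poly f 1) w) = sm f (D w)" for f w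
      using D by (simp add: semilinear_def translate_translate)
    ultimately show "?P D" using D m_gt_1 by (auto simp: t_def)
  qed
  have "\<exists>D. semilinear sm (down 1) D \<and> (\<forall>i\<in>{1..m}. D (u i) = t i)"
  proof (rule semilinear_exists)
    fix i assume i: "i \<in> {1..m}"
    show "sm (down 1 (q i)) (t i) = 0"
    proof (cases "i = 1")
      case False
      with i have "i - 1 \<in> {1..m}" "s i \<le> s (i - 1)" using s_antimono [of "i - 1" i] by auto
      \<comment> \<open>The translated relation contributes the exponent \<open>s i\<close>, and
        \<open>t i\<close> the exponent \<open>s (i - 1) - s i\<close>; their sum
        \<open>s (i - 1)\<close> is what kills \<open>u (i - 1)\<close>.\<close>
      moreover have "down 1 (q i) = pp p1 (i - 1) ^ s i"
        using translate_pp [of 1 i p1] False i by (simp add: translate_power)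
      ultimately show ?thesis
        using False annihilator [of "i - 1"] by (simp add: t_def power_add [symmetric])
    qed (simp add: t_def)
  qed (simp_all add: translate_add translate_mult translate_1)
  then obtain D where D: "semilinear sm (down 1) D \<and> (\<forall>i\<in>{1..m}. D (u i) = t i)" by blast
  show ?thesis unfolding P_iff
    by (rule ex1I [of _ D]) (use D semilinear_eqI in \<open>blast, metis\<close>)
qed

lemma T_semilinear: "semilinear sm (down 1) T"
  and T_u_1: "T (u 1) = 0"
  and T_u: "i \<in> {2..m} \<Longrightarrow> T (u i) = sm (pp p1 (i - 1) ^ (s (i - 1) - s i)) (u (i - 1))"
proof -
  note T = theI' [OF T_ex1, folded op_T_def]
  show "T (u 1) = 0" "i \<in> {2..m} \<Longrightarrow> T (u i) = sm (pp p1 (i - 1) ^ (s (i - 1) - s i)) (u (i - 1))"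
    using T by blast+
  have "T (sm f w) = sm (down 1 f) (T w)" for f w
  proof -
    have "T (sm (translate_poly (down 1 f) 1) w) = sm (down 1 f) (T w)" using T by blast
    then show ?thesis by (simp add: translate_translate)
  qed
  then show "semilinear sm (down 1) T" using T by (simp add: semilinear_def Vector_Spaces.linear_iff)
qed

lemma T_power_semilinear: "semilinear sm (down k) (T ^^ k)"
proof (induction k)
  case (Suc k)
  have "down (Suc k) f = down 1 (down k f)" for f :: "'f poly"
    by (simp add: translate_translate algebra_simps)
  then show ?case using semilinear_comp [OF T_semilinear Suc] by (simp add: o_def)
qed (simp add: semilinear_def)

text \<open>The exponents telescope: each application of \<open>T\<close> translates the power of
  \<open>p_(j+1)\<close> collected so far into one of \<open>p_j\<close> and adds
  \<open>s j - s (j + 1)\<close>.\<close>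

lemma T_power_u:
  assumes "k < i" "i \<le> m"
  shows "(T ^^ k) (u i) = sm (pp p1 (i - k) ^ (s (i - k) - s i)) (u (i - k))"
  using assms
proof (induction k)
  case (Suc k)
  define j where "j = i - Suc k"
  have j: "i - k = Suc j" "j \<ge> 1" "j < m" "Suc j \<le> i" using Suc.prems by (auto simp: j_def)
  have "(T ^^ Suc k) (u i) = T (sm (pp p1 (Suc j) ^ (s (Suc j) - s i)) (u (Suc j)))"
    using Suc j(1) by simp
  also have "\<dots> = sm (down 1 (pp p1 (Suc j) ^ (s (Suc j) - s i))) (T (u (Suc j)))"
    using T_semilinear unfolding semilinear_def by blast
  also have "\<dots> = sm (pp p1 j ^ (s (Suc j) - s i) * pp p1 j ^ (s j - s (Suc j))) (u j)"
    using T_u [of "Suc j"] translate_pp [of 1 "Suc j" p1] j by (simp add: translate_power)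
  also have "pp p1 j ^ (s (Suc j) - s i) * pp p1 j ^ (s j - s (Suc j)) = pp p1 j ^ (s j - s i)"
    using s_antimono [of j "Suc j"] s_antimono [of "Suc j" i] j Suc.prems
    by (simp add: power_add [symmetric])
  finally show ?case by (simp add: j_def)
qed simp

lemma T_power_u_eq_0: "1 \<le> i \<Longrightarrow> i \<le> k \<Longrightarrow> i \<le> m \<Longrightarrow> (T ^^ k) (u i) = 0"
proof (induction k)
  case (Suc k)
  show ?case
  proof (cases "i = Suc k")
    case True
    then have "(T ^^ Suc k) (u i) = T (sm (pp p1 1 ^ (s 1 - s i)) (u 1))"
      using T_power_u [of k i] Suc.prems by simp
    then show ?thesis using T_semilinear T_u_1 by (simp add: semilinear_def)
  qed (use Suc in \<open>simp add: semilinear_0 [OF T_semilinear]\<close>)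
qed auto

text \<open>Truncated subtraction is intended: for \<open>k \<ge> i\<close> the target is
  \<open>fil 0 = {0}\<close>, so nilpotency of \<open>T\<close> is included.\<close>

lemma T_power_fil:
  assumes "w \<in> fil i" "i \<le> m"
  shows "(T ^^ k) w \<in> fil (i - k)"
proof (rule semilinear_fil [OF T_power_semilinear _ assms(1)])
  fix l assume l: "1 \<le> l" "l \<le> i"
  show "(T ^^ k) (u l) \<in> fil (i - k)"
  proof (cases "k < l")
    case True
    then show ?thesis using T_power_u [of k l] generator_in_fil [of "l - k" "i - k"] l assms(2) by simp
  next
    case False
    then show ?thesis using T_power_u_eq_0 [of l k] l assms(2) by (simp add: zero_in_fil)
  qed
qed

text \<open>Injectivity of \<open>T\<close> between consecutive factors. Modulo
  \<open>fil i\<close>, the annihilator of \<open>T (u (i + 2))\<close> is generated by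
  \<open>p_(i+1) ^ s (i + 2)\<close>, which is the translate of \<open>q (i + 2)\<close>; hence only
  multiples of \<open>q (i + 2)\<close> are lost.\<close>

lemma T_fil_strict:
  assumes i: "Suc (Suc i) \<le> m" and w: "w \<in> fil (Suc (Suc i))" and T: "T w \<in> fil i"
  shows "w \<in> fil (Suc i)"
proof -
  let ?r = "pp p1 (Suc i)" and ?k = "Suc (Suc i)"
  obtain h w' where w': "w = sm h (u ?k) + w'" "w' \<in> fil (Suc i)" using w by (rule fil_Suc_cases)
  have "T w = sm (down 1 h) (T (u ?k)) + T w'"
    using T_semilinear unfolding w'(1) semilinear_def by simp
  moreover have "T w' \<in> fil i" using T_power_fil [OF w'(2), of 1] i by simp
  ultimately have "sm (down 1 h) (T (u ?k)) \<in> fil i" using T fil_add_cancel by metis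
  then have "q (Suc i) dvd down 1 h * ?r ^ (s (Suc i) - s ?k)"
    using T_u [of ?k] generator_in_fil_iff [of i] i by simp
  moreover have "s ?k \<le> s (Suc i)" using s_antimono_step [of "Suc i"] i by simp
  then have "q (Suc i) = ?r ^ s ?k * ?r ^ (s (Suc i) - s ?k)" by (simp add: power_add [symmetric])
  ultimately have "?r ^ s ?k dvd down 1 h" using pp_nz by simp
  also have "?r ^ s ?k = down 1 (q ?k)" using translate_pp [of 1 ?k p1] by (simp add: translate_power)
  finally have "q ?k dvd h" by simp
  then have "sm h (u ?k) \<in> fil (Suc i)" using generator_in_fil_iff [of "Suc i"] i by simp
  then show ?thesis using w' fil_add by simp
qed

text \<open>\<open>T ^^ k\<close> turns multiplication by \<open>X\<close> into multiplication by
  \<open>X - k\<close>. So it has weight \<open>k\<close> under commutation with \<open>A\<close>,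
  as the image of a vector of weight \<open>k\<close> must.\<close>

lemma A_T_commute: "A ((T ^^ k) w) - (T ^^ k) (A w) = sm [:of_nat k:] ((T ^^ k) w)"
proof -
  have "(T ^^ k) (A w) = sm (down k [:0, 1:]) ((T ^^ k) w)"
    using T_power_semilinear [of k] unfolding op_A_def semilinear_def by blast
  then show ?thesis
    by (simp add: op_A_def translate_X scale_left_diff_distrib [symmetric])
qed

section \<open>The operator \<open>E\<close> and its polynomials\<close>

lemma E_ex1: "\<exists>!E. module_hom sm sm E \<and> (\<forall>i\<in>{1..m}. E (u i) = sm [:of_nat (i - 1), 1:] (u i))"
proof -
  have hom_iff: "module_hom sm sm D \<longleftrightarrow> semilinear sm (\<lambda>f. f) D" for D
    using module_axioms by (auto simp: module_hom_iff semilinear_def)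
  have "\<exists>D. semilinear sm (\<lambda>f. f) D \<and> (\<forall>i\<in>{1..m}. D (u i) = sm [:of_nat (i - 1), 1:] (u i))"
  proof (rule semilinear_exists)
    fix i assume "i \<in> {1..m}"
    then have "sm (q i) (u i) = 0" by (simp add: annihilator)
    then show "sm (q i) (sm [:of_nat (i - 1), 1:] (u i)) = 0"
      using scale_left_commute by (metis scale_zero_right)
  qed auto
  then obtain D where D: "semilinear sm (\<lambda>f. f) D" "\<forall>i\<in>{1..m}. D (u i) = sm [:of_nat (i - 1), 1:] (u i)"
    by blast
  show ?thesis unfolding hom_iff
    by (rule ex1I [of _ D]) (use D semilinear_eqI in \<open>blast, metis\<close>)
qed

lemma E_semilinear: "semilinear sm (\<lambda>f. f) E"
  and E_u: "i \<in> {1..m} \<Longrightarrow> E (u i) = sm [:of_nat (i - 1), 1:] (u i)"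
  using theI' [OF E_ex1, folded op_E_def] by (auto simp: module_hom_iff semilinear_def)

lemma E_power_semilinear: "semilinear sm (\<lambda>f. f) (E ^^ k)"
proof (induction k)
  case (Suc k)
  then show ?case using semilinear_comp [OF E_semilinear Suc] by (simp add: o_def)
qed (simp add: semilinear_def)

lemma E_power_u: "i \<in> {1..m} \<Longrightarrow> (E ^^ k) (u i) = sm ([:of_nat (i - 1), 1:] ^ k) (u i)"
proof (induction k)
  case (Suc k)
  then show ?case using E_semilinear E_u [of i] by (simp add: semilinear_def mult.commute)
qed simp

lemma at_E_semilinear: "semilinear sm (\<lambda>f. f) (at_E g)"
proof -
  have "(E ^^ k) (v + w) = (E ^^ k) v + (E ^^ k) w" "(E ^^ k) (sm f w) = sm f ((E ^^ k) w)" for k v w f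
    using E_power_semilinear [of k] by (simp_all add: semilinear_def)
  then show ?thesis
    unfolding semilinear_def poly_of_op_def restrict_scale_def
    by (simp add: scale_right_distrib sum.distrib scale_sum_right mult.commute)
qed

lemma at_E_u:
  assumes "i \<in> {1..m}"
  shows "at_E g (u i) = sm (translate_poly g (of_nat (i - 1))) (u i)"
proof -
  have "at_E g (u i) = (\<Sum>k\<le>degree g. sm (smult (coeff g k) ([:of_nat (i - 1), 1:] ^ k)) (u i))"
    unfolding poly_of_op_def restrict_scale_def by (simp only: E_power_u [OF assms] scale_scale) simp
  also have "\<dots> = sm (translate_poly g (of_nat (i - 1))) (u i)"
    unfolding translate_poly_def pcompose_as_sum by (simp only: scale_sum_left)
  finally show ?thesis .
qed

lemma at_E_scale: "at_E g (sm f w) = sm f (at_E g w)"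
  and at_E_plus: "at_E g (v + w) = at_E g v + at_E g w"
  using at_E_semilinear by (simp_all add: semilinear_def)

lemma at_E_add: "at_E (g + h) w = at_E g w + at_E h w"
proof -
  have "at_E (g + h) = (\<lambda>w. at_E g w + at_E h w)"
  proof (rule semilinear_eqI [OF at_E_semilinear])
    show "semilinear sm (\<lambda>f. f) (\<lambda>w. at_E g w + at_E h w)"
      unfolding semilinear_def by (simp add: at_E_scale at_E_plus scale_right_distrib)
  qed (simp add: at_E_u translate_add scale_left_distrib)
  then show ?thesis by simp
qed

lemma at_E_smult: "at_E (smult c g) w = sm [:c:] (at_E g w)"
proof -
  have "at_E (smult c g) = (\<lambda>w. sm [:c:] (at_E g w))"
  proof (rule semilinear_eqI [OF at_E_semilinear])
    show "semilinear sm (\<lambda>f. f) (\<lambda>w. sm [:c:] (at_E g w))"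
      unfolding semilinear_def by (simp add: at_E_scale at_E_plus scale_right_distrib mult.commute)
  qed (simp add: at_E_u translate_smult)
  then show ?thesis by simp
qed

lemma at_E_1: "at_E 1 w = w"
proof -
  have "at_E 1 = (\<lambda>w. w)"
    by (rule semilinear_eqI [OF at_E_semilinear]) (simp_all add: semilinear_def at_E_u translate_1)
  then show ?thesis by simp
qed

lemma at_E_commute: "at_E g (at_E h w) = at_E h (at_E g w)"
proof -
  have "(\<lambda>w. at_E g (at_E h w)) = (\<lambda>w. at_E h (at_E g w))"
    by (rule semilinear_eqI [where \<tau> = "\<lambda>f. f"])
       (simp_all add: semilinear_comp [OF at_E_semilinear at_E_semilinear] at_E_u at_E_scale mult.commute)
  then show ?thesis by meson
qed

text \<open>This explains the shifts in \<open>E\<close>: on \<open>u i\<close> it is multiplication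
  by \<open>X + (i - 1)\<close>, which \<open>T ^^ k\<close> translates to
  \<open>X + (i - k - 1)\<close>, the action of \<open>E\<close> on
  \<open>u (i - k)\<close>.\<close>

lemma at_E_T_commute: "(T ^^ k) (at_E g w) = at_E g ((T ^^ k) w)"
proof -
  have "(\<lambda>w. (T ^^ k) (at_E g w)) = (\<lambda>w. at_E g ((T ^^ k) w))"
  proof (rule semilinear_eqI [where \<tau> = "down k"])
    fix i assume i: "i \<in> {1..m}"
    have "(T ^^ k) (at_E g (u i)) = sm (translate_poly g (of_nat (i - 1) - of_nat k)) ((T ^^ k) (u i))"
      using T_power_semilinear [of k] by (simp add: at_E_u [OF i] semilinear_def translate_translate)
    also have "\<dots> = at_E g ((T ^^ k) (u i))"
    proof (cases "k < i")
      case True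
      then have "i - 1 = (i - k - 1) + k" by simp
      then have "(of_nat (i - 1) :: 'f) - of_nat k = of_nat (i - k - 1)"
        by (metis add_diff_cancel_right' of_nat_add)
      moreover have "at_E g (u (i - k)) = sm (translate_poly g (of_nat (i - k - 1))) (u (i - k))"
        using True i by (intro at_E_u) auto
      ultimately show ?thesis using True i T_power_u [of k i]
        by (simp only: at_E_scale) (simp add: at_E_scale mult.commute)
    next
      case False
      then have "(T ^^ k) (u i) = 0" using T_power_u_eq_0 [of i k] i by simp
      then show ?thesis using semilinear_0 [OF at_E_semilinear] by simp
    qed
    finally show "(T ^^ k) (at_E g (u i)) = at_E g ((T ^^ k) (u i))" .
  qed (rule semilinear_comp [OF T_power_semilinear at_E_semilinear]
            semilinear_comp [OF at_E_semilinear T_power_semilinear])+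
  then show ?thesis by meson
qed

lemma at_E_fil:
  assumes "w \<in> fil i" "i \<le> m"
  shows "at_E g w \<in> fil i"
proof (rule semilinear_fil [OF at_E_semilinear _ assms(1)])
  fix k assume "1 \<le> k" "k \<le> i"
  then show "at_E g (u k) \<in> fil i" using at_E_u [of k] generator_in_fil assms(2) by simp
qed

lemma at_E_fil_factor:
  assumes "Suc i \<le> m" and "w \<in> fil (Suc i)"
  shows "at_E g w - sm (translate_poly g (of_nat i)) w \<in> fil i"
proof -
  obtain h w' where w: "w = sm h (u (Suc i)) + w'" "w' \<in> fil i"
    using assms(2) by (rule fil_Suc_cases)
  have "at_E g w - sm (translate_poly g (of_nat i)) w =
      at_E g w' - sm (translate_poly g (of_nat i)) w'"
    using at_E_u [of "Suc i" g] assms(1)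
    by (simp add: w(1) at_E_plus at_E_scale scale_right_distrib mult.commute)
  then show ?thesis using w(2) assms(1) at_E_fil [of w' i] by (simp add: fil_diff fil_scale)
qed

lemma finite_dimensional: "\<exists>B. finite B \<and> V.span B = UNIV"
proof -
  \<comment> \<open>\<open>degree p1 * s 1\<close> bounds the degrees of all \<open>q i\<close>,
    since \<open>s\<close> is decreasing; remainders modulo \<open>q i\<close> then need only these
    monomials.\<close>
  define B where "B = (\<lambda>(i, k). sm (monom 1 k) (u i)) ` ({1..m} \<times> {..<degree p1 * s 1})"
  have sm_span: "sm f (u i) \<in> V.span B" if i: "i \<in> {1..m}" for f i
  proof -
    have "q i \<noteq> 0" using pp_nz by simp
    have deg_q: "degree (q i) \<le> degree p1 * s 1"
      using degree_monic_power [of "pp p1 i" "s i"] s_antimono [of 1 i] monic i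
      by (simp add: lead_coeff_pp del: degree_pp) (simp add: mult.commute)
    \<comment> \<open>Needed for a zero remainder, whose degree is 0 by convention.\<close>
    have deg_q_pos: "degree (q i) > 0"
      using degree_monic_power [of "pp p1 i" "s i"] monic s_pos [OF i] degree_p1
      by (simp add: lead_coeff_pp del: degree_pp) simp
    have "sm (f - f mod q i) (u i) = 0" using annihilator [OF i] by simp
    then have "sm f (u i) = sm (f mod q i) (u i)" by (simp add: scale_left_diff_distrib)
    also have "f mod q i = (\<Sum>k\<le>degree (f mod q i). [:coeff (f mod q i) k:] * monom 1 k)"
      by (subst poly_as_sum_of_monoms [symmetric]) (simp add: smult_monom)
    also have "sm \<dots> (u i) =
        (\<Sum>k\<le>degree (f mod q i). restrict_scale sm (coeff (f mod q i) k) (sm (monom 1 k) (u i)))"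
      unfolding scale_sum_left restrict_scale_def scale_scale ..
    also have "\<dots> \<in> V.span B"
    proof (intro V.span_sum V.span_scale V.span_base)
      fix k assume "k \<in> {..degree (f mod q i)}"
      moreover have "degree (f mod q i) < degree (q i)"
        using degree_mod_less [OF \<open>q i \<noteq> 0\<close>, of f] deg_q_pos by auto
      ultimately show "sm (monom 1 k) (u i) \<in> B"
        unfolding B_def using i deg_q by (intro image_eqI [of _ _ "(i, k)"]) auto
    qed
    finally show ?thesis .
  qed
  have "w \<in> V.span B" for w
  proof -
    obtain c where "w = (\<Sum>i=1..m. sm (c i) (u i))" using coordinates by blast
    then show ?thesis using sm_span V.span_sum by (metis (no_types, lifting))
  qed
  moreover have "finite B" unfolding B_def by simp
  ultimately show ?thesis by blast
qed

end

section \<open>The representation\<close>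

lemma (in lie_algebra) br_antisym: "br x z = - br z x"
proof -
  have "br (x + z) (x + z) = br x z + br z x" by (simp only: br_add_left br_add_right) (simp add: br_self)
  then show ?thesis by (simp add: br_self eq_neg_iff_add_eq_0)
qed

lemma (in lie_algebra) br_sum_right: "br x (sum f I) = (\<Sum>i\<in>I. br x (f i))"
proof -
  have "br x 0 = 0" using br_add_right [of x 0 0] by (metis add_cancel_right_right)
  then show ?thesis by (induction I rule: infinite_finite_induct) (simp_all add: br_add_right)
qed

locale graded_rep = lie_algebra hs br
  for hs :: "'f::field \<Rightarrow> 'h::ab_group_add \<Rightarrow> 'h" (infixr "*s" 75) and br :: "'h \<Rightarrow> 'h \<Rightarrow> 'h" +
  fixes y v :: 'h and a :: "'h set" and m :: nat and p1 :: "'f poly" and s :: "nat \<Rightarrow> nat"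
    and g :: "nat \<Rightarrow> 'h \<Rightarrow> 'f poly"
    and sm :: "'f poly \<Rightarrow> 'u::ab_group_add \<Rightarrow> 'u" and u :: "nat \<Rightarrow> 'u"
  assumes diag: "diag_semidirect y a" and v_weight: "v \<in> weight_space y a 1"
    and data: "rep_data y a v m p1 s g" and torsion_mod: "torsion_module sm m p1 s u"
begin

sublocale U: torsion sm m p1 s u
  by unfold_locales (use data torsion_mod in \<open>auto simp: rep_data_def\<close>)

abbreviation R :: "'h \<Rightarrow> 'u \<Rightarrow> 'u" where
  "R \<equiv> rep_R y a sm m p1 s u g"

text \<open>The index is the weight as a field element, so that exponents \<open>k\<close> which
  coincide in \<open>F\<close> are collected in one operator and all weights are treated
  alike.\<close>

definition wt_op :: "'f \<Rightarrow> 'h \<Rightarrow> 'u \<Rightarrow> 'u" where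
  "wt_op \<gamma> x w = (\<Sum>k | k < m \<and> of_nat k = \<gamma>. U.at_E (g k x) ((U.T ^^ k) w))"

lemma ideal_a: "subspace a" "x \<in> a \<Longrightarrow> br z x \<in> a"
  and abelian_a: "x \<in> a \<Longrightarrow> z \<in> a \<Longrightarrow> br x z = 0"
  and decompose: "\<exists>c. \<exists>z\<in>a. x = c *s y + z"
  using diag unfolding diag_semidirect_def lie_ideal_def by blast+

lemma weight_space_subspace: "subspace (weight_space y a \<gamma>)"
  using ideal_a(1) br_add_right [of y 0 0]
  by (auto simp: subspace_def weight_space_def br_add_right br_scale_right scale_right_distrib
      scale_left_commute)

lemma g_add: "k < m \<Longrightarrow> x \<in> weight_space y a (of_nat k) \<Longrightarrow> z \<in> weight_space y a (of_nat k) \<Longrightarrow>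
    g k (x + z) = g k x + g k z"
  and g_scale: "k < m \<Longrightarrow> x \<in> weight_space y a (of_nat k) \<Longrightarrow> g k (c *s x) = smult c (g k x)"
  and g_below: "k < m \<Longrightarrow> x \<in> weight_space y a (of_nat k) \<Longrightarrow> g k x \<in> poly_below (degree p1 * s (k + 1))"
  and g_v: "g 1 v = 1"
  using data unfolding rep_data_def by blast+

lemma wt_op_add:
  assumes "x \<in> weight_space y a \<gamma>" and "z \<in> weight_space y a \<gamma>"
  shows "wt_op \<gamma> (x + z) w = wt_op \<gamma> x w + wt_op \<gamma> z w"
  using assms unfolding wt_op_def sum.distrib [symmetric]
  by (intro sum.cong) (auto simp: g_add U.at_E_add)

lemma wt_op_scale:
  assumes "x \<in> weight_space y a \<gamma>"
  shows "wt_op \<gamma> (c *s x) w = restrict_scale sm c (wt_op \<gamma> x w)"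
proof -
  have "wt_op \<gamma> (c *s x) w = sm [:c:] (wt_op \<gamma> x w)"
    using assms unfolding wt_op_def U.scale_sum_right
    by (intro sum.cong) (auto simp: g_scale U.at_E_smult)
  then show ?thesis by (simp add: restrict_scale_def)
qed

lemma wt_op_sum:
  assumes "\<And>b. b \<in> B \<Longrightarrow> f b \<in> weight_space y a \<gamma>"
  shows "wt_op \<gamma> (sum f B) w = (\<Sum>b\<in>B. wt_op \<gamma> (f b) w)"
proof -
  have "wt_op \<gamma> 0 w = 0"
    using wt_op_scale [OF subspace_0 [OF weight_space_subspace], of \<gamma> 0 w] by simp
  then show ?thesis using assms
    by (induction B rule: infinite_finite_induct)
       (simp_all add: wt_op_add subspace_sum [OF weight_space_subspace])
qed

text \<open>The algebra is spanned by \<open>y\<close> and weight vectors, so properties stable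
  under linear combinations need only be checked on these.\<close>

lemma weight_induct:
  assumes "P y" and wt: "\<And>\<gamma> x. x \<in> weight_space y a \<gamma> \<Longrightarrow> P x"
    and add: "\<And>x z. P x \<Longrightarrow> P z \<Longrightarrow> P (x + z)" and scale: "\<And>c x. P x \<Longrightarrow> P (c *s x)"
  shows "P x"
proof -
  obtain B where B: "span B = a" "\<And>b. b \<in> B \<Longrightarrow> \<exists>\<gamma>. b \<in> weight_space y a \<gamma>"
    using diag unfolding diag_semidirect_def by blast
  obtain c z where x: "x = c *s y + z" "z \<in> a" using decompose by blast
  have "z \<in> span B" using x B by simp
  then have "P z"
  proof (induction rule: span_induct_alt)
    case base
    show ?case using wt [OF subspace_0 [OF weight_space_subspace]] .
  qed (use B wt add scale in blast)
  then show ?thesis using x add scale \<open>P y\<close> by blast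
qed

text \<open>The defining conditions of \<open>rep_R\<close> for the weights in \<open>{0..m-1}\<close> and for the others say
  the same, since the sum in \<open>wt_op\<close> is empty for the latter.\<close>

lemma R_spec:
  "(\<forall>w. Vector_Spaces.linear hs (restrict_scale sm) (\<lambda>x. S x w)) \<and> S y = U.A \<and>
     (\<forall>j<m. \<forall>x\<in>weight_space y a (of_nat j). S x = (\<lambda>w.
        \<Sum>k | k < m \<and> (of_nat k :: 'f) = of_nat j. U.at_E (g k x) ((U.T ^^ k) w))) \<and>
     (\<forall>\<gamma>. \<gamma> \<notin> of_nat ` {..<m} \<longrightarrow> (\<forall>x\<in>weight_space y a \<gamma>. S x = (\<lambda>w. 0))) \<longleftrightarrow>
   (\<forall>w. Vector_Spaces.linear hs (restrict_scale sm) (\<lambda>x. S x w)) \<and> S y = U.A \<and>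
     (\<forall>\<gamma>. \<forall>x\<in>weight_space y a \<gamma>. S x = wt_op \<gamma> x)"
proof -
  have other: "wt_op \<gamma> x = (\<lambda>w. 0)" if "\<gamma> \<notin> of_nat ` {..<m}" for \<gamma> x
  proof
    fix w
    have none: "{k. k < m \<and> of_nat k = \<gamma>} = {}" using that by auto
    show "wt_op \<gamma> x w = 0" unfolding wt_op_def none by simp
  qed
  have "(\<forall>j<m. \<forall>x\<in>weight_space y a (of_nat j). S x = wt_op (of_nat j) x) \<and>
      (\<forall>\<gamma>. \<gamma> \<notin> of_nat ` {..<m} \<longrightarrow> (\<forall>x\<in>weight_space y a \<gamma>. S x = (\<lambda>w. 0))) \<longleftrightarrow>
      (\<forall>\<gamma>. \<forall>x\<in>weight_space y a \<gamma>. S x = wt_op \<gamma> x)" (is "?L \<longleftrightarrow> ?R")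
  proof
    assume ?L
    show ?R
    proof (intro allI ballI)
      fix \<gamma> x assume "x \<in> weight_space y a \<gamma>"
      with \<open>?L\<close> show "S x = wt_op \<gamma> x"
        using other [of \<gamma> x] by (cases "\<gamma> \<in> of_nat ` {..<m}") auto
    qed
  next
    assume ?R
    then show ?L using other by auto
  qed
  then show ?thesis unfolding wt_op_def [abs_def] by blast
qed

text \<open>A linear map is free on the basis consisting of \<open>y\<close> and an eigenbasis of
  \<open>a\<close>, but the operator is prescribed on every weight vector. Consistency holds because
  a vector of weight \<open>\<gamma>\<close> involves only basis vectors of weight
  \<open>\<gamma>\<close>, and \<open>wt_op \<gamma>\<close> is linear there.\<close>

lemma R_ex1:
  "\<exists>!S. (\<forall>w. Vector_Spaces.linear hs (restrict_scale sm) (\<lambda>x. S x w)) \<and> S y = U.A \<and>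
     (\<forall>\<gamma>. \<forall>x\<in>weight_space y a \<gamma>. S x = wt_op \<gamma> x)" (is "\<exists>!S. ?P S")
proof -
  interpret VP: vector_space_pair hs "restrict_scale sm" ..
  obtain B where B: "independent B" "span B = a" "\<And>b. b \<in> B \<Longrightarrow> \<exists>\<gamma>. b \<in> weight_space y a \<gamma>"
    using diag unfolding diag_semidirect_def by blast
  obtain wt where wt: "\<And>b. b \<in> B \<Longrightarrow> b \<in> weight_space y a (wt b)" using B(3) by metis
  have "y \<notin> span B" using diag span_base [of y "{y}"] B(2) unfolding diag_semidirect_def by blast
  then have "y \<notin> B" and ind: "independent (insert y B)"
    using B(1) span_base independent_insertI by blast+
  have fin: "finite B"
    using finite_dim independent_span_bound [OF _ B(1)] by auto
  define S where
    "S x w = VP.construct (insert y B) (\<lambda>b. if b = y then U.A w else wt_op (wt b) b w) x" for x w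
  have lin: "Vector_Spaces.linear hs (restrict_scale sm) (\<lambda>x. S x w)" for w
    unfolding S_def using VP.linear_construct [OF ind] by (simp add: eta_contract_eq)
  have S_y: "S y = U.A"
    unfolding S_def using VP.construct_basis [OF ind, of y] by auto
  have S_b: "S b w = wt_op (wt b) b w" if "b \<in> B" for b w
    unfolding S_def using VP.construct_basis [OF ind, of b] that \<open>y \<notin> B\<close> by auto
  have S_wt: "S x w = wt_op \<gamma> x w" if x: "x \<in> weight_space y a \<gamma>" for x \<gamma> w
  proof -
    interpret L: Vector_Spaces.linear hs "restrict_scale sm" "\<lambda>x. S x w" by (rule lin)
    have "x \<in> span B" using x B(2) by (simp add: weight_space_def)
    then obtain r where r: "x = (\<Sum>b\<in>B. r b *s b)" using span_finite [OF fin] by auto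
    \<comment> \<open>Two expansions of \<open>br y x\<close>: comparing coefficients gives
      \<open>wt b = \<gamma>\<close> whenever \<open>r b\<close> is non-zero.\<close>
    have "br y x = (\<Sum>b\<in>B. (r b * wt b) *s b)"
      unfolding r br_sum_right using wt
      by (intro sum.cong) (auto simp: br_scale_right weight_space_def)
    moreover have "br y x = (\<Sum>b\<in>B. (r b * \<gamma>) *s b)"
      using x unfolding weight_space_def r by (simp add: scale_sum_right mult.commute)
    ultimately have "(\<Sum>b\<in>B. (r b * wt b - r b * \<gamma>) *s b) = 0"
      by (simp add: scale_left_diff_distrib sum_subtractf)
    then have eq: "r b * wt b - r b * \<gamma> = 0" if "b \<in> B" for b
      using independentD [OF B(1) fin subset_refl, of "\<lambda>b. r b * wt b - r b * \<gamma>"] that by blast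
    have summand: "r b *s b \<in> weight_space y a \<gamma> \<and> S (r b *s b) w = wt_op \<gamma> (r b *s b) w"
      if b: "b \<in> B" for b
    proof (cases "r b = 0")
      case True
      have "0 \<in> weight_space y a \<gamma>" by (rule subspace_0 [OF weight_space_subspace])
      moreover have "wt_op \<gamma> 0 w = 0" using wt_op_sum [of "{}"] by simp
      ultimately show ?thesis using True L.zero by simp
    next
      case False
      then have "wt b = \<gamma>" using eq [OF b] by simp
      with wt [OF b] show ?thesis
        by (simp add: subspace_scale [OF weight_space_subspace] wt_op_scale L.scale S_b [OF b])
    qed
    have "S x w = (\<Sum>b\<in>B. S (r b *s b) w)" unfolding r by (rule L.sum)
    also have "\<dots> = (\<Sum>b\<in>B. wt_op \<gamma> (r b *s b) w)" by (intro sum.cong) (auto simp: summand)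
    also have "\<dots> = wt_op \<gamma> x w" unfolding r by (rule wt_op_sum [symmetric]) (simp add: summand)
    finally show ?thesis .
  qed
  have "?P S" using lin S_y S_wt by blast
  moreover have "S' = S''" if S': "?P S'" and S'': "?P S''" for S' S''
  proof (intro ext)
    fix x w
    show "S' x w = S'' x w"
      by (induction x rule: weight_induct) (use S' S'' in \<open>simp_all add: Vector_Spaces.linear_iff\<close>)
  qed
  ultimately show ?thesis by blast
qed

lemma R_linear: "Vector_Spaces.linear hs (restrict_scale sm) (\<lambda>x. R x w)"
  and R_y: "R y = U.A"
  and R_weight: "x \<in> weight_space y a \<gamma> \<Longrightarrow> R x = wt_op \<gamma> x"
  using theI' [OF R_ex1] unfolding rep_R_def R_spec by blast+

lemma R_add_left: "R (x + z) w = R x w + R z w"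
  and R_scale_left: "R (c *s x) w = restrict_scale sm c (R x w)"
  using R_linear [of w] by (simp_all add: Vector_Spaces.linear_iff)

section \<open>Linearity of the operators and the bracket relation\<close>

lemma R_add_right: "R x (w + w') = R x w + R x w'"
proof (induction x rule: weight_induct)
  case 1
  show ?case by (simp add: R_y op_A_def U.scale_right_distrib)
next
  case (2 \<gamma> x)
  have "(U.T ^^ k) (w + w') = (U.T ^^ k) w + (U.T ^^ k) w'" for k
    using U.T_power_semilinear [of k] by (simp add: semilinear_def)
  with 2 show ?case by (simp add: R_weight wt_op_def U.at_E_plus sum.distrib)
qed (simp_all add: R_add_left R_scale_left U.V.scale_right_distrib)

lemma R_scale_right: "R x (restrict_scale sm c w) = restrict_scale sm c (R x w)"
proof (induction x rule: weight_induct)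
  case 1
  show ?case by (simp add: R_y op_A_def restrict_scale_def)
next
  case (2 \<gamma> x)
  have "(U.T ^^ k) (sm [:c:] w) = sm [:c:] ((U.T ^^ k) w)" for k
    using U.T_power_semilinear [of k] by (simp add: semilinear_def translate_const)
  with 2 show ?case by (simp add: R_weight wt_op_def restrict_scale_def U.at_E_scale U.scale_sum_right)
qed (simp_all add: R_add_left R_scale_left U.V.scale_right_distrib U.V.scale_left_commute)

lemma R_sum_right: "R x (sum f I) = (\<Sum>i\<in>I. R x (f i))"
  and R_0_right [simp]: "R x 0 = 0"
proof -
  show zero: "R x 0 = 0" using R_add_right [of x 0 0] by (metis add_cancel_right_right)
  show "R x (sum f I) = (\<Sum>i\<in>I. R x (f i))"
    by (induction I rule: infinite_finite_induct) (simp_all add: zero R_add_right)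
qed

text \<open>Each \<open>g(E)\<close> commutes with \<open>A\<close>, being
  \<open>F[X]\<close>-linear, so only the commutator of \<open>A\<close> with \<open>T ^^ k\<close>
  remains. It is \<open>k\<close> times \<open>T ^^ k\<close>, and every \<open>k\<close> in the sum
  equals \<open>\<gamma>\<close> in \<open>F\<close>.\<close>

lemma R_br_y: "x \<in> weight_space y a \<gamma> \<Longrightarrow> R (br y x) w = R y (R x w) - R x (R y w)"
proof -
  assume x: "x \<in> weight_space y a \<gamma>"
  have "R y (R x w) - R x (R y w) =
      (\<Sum>k | k < m \<and> of_nat k = \<gamma>. U.at_E (g k x) (U.A ((U.T ^^ k) w) - (U.T ^^ k) (U.A w)))"
    unfolding R_y R_weight [OF x] wt_op_def
    by (simp add: op_A_def U.scale_sum_right sum_subtractf U.semilinear_diff [OF U.at_E_semilinear]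
        U.at_E_scale)
  also have "\<dots> = (\<Sum>k | k < m \<and> of_nat k = \<gamma>. sm [:\<gamma>:] (U.at_E (g k x) ((U.T ^^ k) w)))"
    by (intro sum.cong) (auto simp: U.A_T_commute U.at_E_scale)
  also have "\<dots> = restrict_scale sm \<gamma> (R x w)"
    by (simp add: R_weight [OF x] wt_op_def restrict_scale_def U.scale_sum_right)
  also have "\<dots> = R (br y x) w" using x by (simp add: weight_space_def R_scale_left)
  finally show ?thesis by simp
qed

text \<open>Polynomials in \<open>E\<close> and powers of \<open>T\<close> all commute with each
  other, which matches \<open>a\<close> being abelian.\<close>

lemma R_weight_commute:
  assumes x: "x \<in> weight_space y a \<gamma>" and z: "z \<in> weight_space y a \<delta>"
  shows "R x (R z w) = R z (R x w)"
proof -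
  have comm: "U.at_E f ((U.T ^^ k) (U.at_E h ((U.T ^^ l) w))) =
      U.at_E h ((U.T ^^ l) (U.at_E f ((U.T ^^ k) w)))" for f h k l w
  proof -
    have "(U.T ^^ k) ((U.T ^^ l) w) = (U.T ^^ l) ((U.T ^^ k) w)"
      by (metis add.commute comp_apply funpow_add)
    then show ?thesis by (simp add: U.at_E_T_commute U.at_E_commute [of f h])
  qed
  have "wt_op \<gamma> x (wt_op \<delta> z w) =
      (\<Sum>l | l < m \<and> of_nat l = \<delta>. wt_op \<gamma> x (U.at_E (g l z) ((U.T ^^ l) w)))"
    unfolding R_weight [OF x, symmetric] by (simp add: wt_op_def R_sum_right)
  also have "\<dots> = (\<Sum>k | k < m \<and> of_nat k = \<gamma>. wt_op \<delta> z (U.at_E (g k x) ((U.T ^^ k) w)))"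
    unfolding wt_op_def by (subst sum.swap) (simp only: comm)
  also have "\<dots> = wt_op \<delta> z (wt_op \<gamma> x w)"
    unfolding R_weight [OF z, symmetric] by (simp add: wt_op_def R_sum_right)
  finally show ?thesis by (simp add: R_weight [OF x] R_weight [OF z])
qed

lemma R_minus_left: "R (- x) w = - R x w"
  using R_add_left [of "-x" x w] R_scale_left [of 0 x w] by (simp add: eq_neg_iff_add_eq_0)

lemma R_br: "R (br x z) w = R x (R z w) - R z (R x w)"
proof (induction x arbitrary: w rule: weight_induct)
  case 1
  show ?case
  proof (induction z arbitrary: w rule: weight_induct)
    case 1
    show ?case using R_scale_left [of 0 y w] by (simp add: br_self)
  next
    case (2 \<gamma> z)
    then show ?case by (rule R_br_y)
  next
    case (3 x z)
    then show ?case by (simp add: br_add_right R_add_left R_add_right)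
  next
    case (4 c x)
    then show ?case by (simp add: br_scale_right R_scale_left R_scale_right U.V.scale_right_diff_distrib)
  qed
next
  case (2 \<gamma> x)
  show ?case
  proof (induction z arbitrary: w rule: weight_induct)
    case 1
    show ?case using R_br_y [OF 2, of w] br_antisym [of x y] by (simp add: R_minus_left)
  next
    case (2 \<delta> z)
    then have "br x z = 0"
      using \<open>x \<in> weight_space y a \<gamma>\<close> abelian_a by (simp add: weight_space_def)
    then show ?case
      using R_scale_left [of 0 x w] R_weight_commute [OF \<open>x \<in> weight_space y a \<gamma>\<close> 2] by simp
  next
    case (3 x z)
    then show ?case by (simp add: br_add_right R_add_left R_add_right)
  next
    case (4 c x)
    then show ?case by (simp add: br_scale_right R_scale_left R_scale_right U.V.scale_right_diff_distrib)
  qed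
next
  case (3 x z)
  then show ?case by (simp add: br_add_left R_add_left R_add_right)
next
  case (4 c x)
  then show ?case by (simp add: br_scale_left R_scale_left R_scale_right U.V.scale_right_diff_distrib)
qed

sublocale lie_rep hs br "restrict_scale sm" R
  by unfold_locales
     (simp_all add: U.finite_dimensional R_add_right R_scale_right R_add_left R_scale_left R_br)

subsection \<open>The nilpotency series\<close>

text \<open>All brackets lie in the abelian ideal \<open>a\<close>, so the second derived term
  vanishes, the algebra is solvable, and it is its own radical.\<close>

lemma nil_ideal_eq: "nil_ideal = bracket UNIV UNIV"
proof -
  have br_in_a: "br x z \<in> a" for x z
  proof -
    obtain c x' where x: "x = c *s y + x'" "x' \<in> a" using decompose by blast
    obtain d z' where z: "z = d *s y + z'" "z' \<in> a" using decompose by blast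
    have "br x z = c *s br y z' + d *s br x' y"
      unfolding x(1) z(1) br_add_left br_add_right br_scale_left br_scale_right
      by (simp add: br_self abelian_a x z)
    moreover have "br x' y = - br y x'" by (rule br_antisym)
    ultimately show ?thesis
      using ideal_a x(2) z(2) by (simp add: subspace_diff subspace_scale)
  qed
  have derived_1: "bracket UNIV UNIV \<subseteq> a"
    unfolding bracket_def by (rule span_minimal) (auto simp: br_in_a ideal_a(1))
  have "bracket (bracket UNIV UNIV) (bracket UNIV UNIV) \<subseteq> {0}"
    unfolding bracket_def [of "bracket UNIV UNIV"]
    by (rule span_minimal) (use abelian_a derived_1 in \<open>auto simp: subspace_single_0\<close>)
  then have "derived_series UNIV 2 = {0}"
    using span_zero by (auto simp: numeral_2_eq_2 bracket_def)
  then have "solvable_ideal UNIV" unfolding solvable_ideal_def lie_ideal_def by auto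
  then have "\<Union> {I. solvable_ideal I} = UNIV" by blast
  then have "radical = UNIV" by (simp add: radical_def)
  then show ?thesis by (simp add: nil_ideal_def)
qed

lemma v_nil_ideal: "v \<in> nil_ideal"
proof -
  have "br y v = v" using v_weight by (simp add: weight_space_def)
  then show ?thesis unfolding nil_ideal_eq bracket_def
    by (intro span_base CollectI exI [of _ y] exI [of _ v]) simp
qed

text \<open>On a factor, \<open>y\<close> is multiplication by \<open>X\<close>, positive powers of
  \<open>T\<close> vanish, and \<open>g(E)\<close> is multiplication by \<open>g(X + i)\<close>, the
  shift belonging to the generator \<open>u (Suc i)\<close>.\<close>

lemma R_fil_factor:
  assumes i: "Suc i \<le> m"
  shows "\<exists>f. \<forall>w\<in>U.fil (Suc i). R x w - sm f w \<in> U.fil i"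
proof (induction x rule: weight_induct)
  case 1
  show ?case by (rule exI [of _ "[:0, 1:]"]) (simp add: R_y op_A_def U.zero_in_fil)
next
  case (2 \<gamma> x)
  have "\<exists>f. \<forall>w\<in>U.fil (Suc i). U.at_E (g k x) ((U.T ^^ k) w) - sm f w \<in> U.fil i" for k
  proof (cases k)
    case 0
    then show ?thesis using U.at_E_fil_factor [OF i] by auto
  next
    case (Suc l)
    have "U.at_E (g k x) ((U.T ^^ k) w) \<in> U.fil i" if "w \<in> U.fil (Suc i)" for w
      using U.T_power_fil [OF that i, of k] U.fil_mono [of "Suc i - k" i] U.at_E_fil i Suc by auto
    then show ?thesis by (intro exI [of _ 0]) simp
  qed
  then obtain f where f: "w \<in> U.fil (Suc i) \<Longrightarrow> U.at_E (g k x) ((U.T ^^ k) w) - sm (f k) w \<in> U.fil i"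
    for k w by metis
  show ?case
  proof (intro exI ballI)
    fix w assume "w \<in> U.fil (Suc i)"
    then show "R x w - sm (\<Sum>k | k < m \<and> of_nat k = \<gamma>. f k) w \<in> U.fil i"
      unfolding R_weight [OF 2] wt_op_def U.scale_sum_left sum_subtractf [symmetric]
      by (intro U.fil_sum f)
  qed
next
  case (3 x z)
  then obtain f h where f: "\<forall>w\<in>U.fil (Suc i). R x w - sm f w \<in> U.fil i"
    and h: "\<forall>w\<in>U.fil (Suc i). R z w - sm h w \<in> U.fil i" by blast
  have "R (x + z) w - sm (f + h) w = (R x w - sm f w) + (R z w - sm h w)" for w
    by (simp add: R_add_left U.scale_left_distrib)
  then show ?case using f h U.fil_add by metis
next
  case (4 c x)
  then obtain f where f: "\<forall>w\<in>U.fil (Suc i). R x w - sm f w \<in> U.fil i" by blast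
  have "R (c *s x) w - sm ([:c:] * f) w = sm [:c:] (R x w - sm f w)" for w
    by (simp only: R_scale_left restrict_scale_def U.scale_right_diff_distrib U.scale_scale)
  then show ?case using f U.fil_scale by metis
qed

lemma R_fil:
  assumes "w \<in> U.fil i" "i \<le> m"
  shows "R x w \<in> U.fil i"
proof (cases i)
  case 0
  then show ?thesis using assms by (simp add: U.fil_0)
next
  case (Suc l)
  then obtain f where "R x w - sm f w \<in> U.fil l" using R_fil_factor [of l x] assms by blast
  then have "R x w - sm f w \<in> U.fil i" using U.fil_mono [of l i] Suc by auto
  then show ?thesis using U.fil_add [OF _ U.fil_scale [OF assms(1), of f]] by fastforce
qed

text \<open>Every element of the algebra acts on a factor of the filtration as multiplication by a
  polynomial, so commutators act as zero there.\<close>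

lemma R_nil_ideal_fil:
  assumes i: "Suc i \<le> m" and w: "w \<in> U.fil (Suc i)" and x: "x \<in> nil_ideal"
  shows "R x w \<in> U.fil i"
proof -
  have comm: "R (br x z) w \<in> U.fil i" for x z
  proof -
    obtain f where f: "\<And>w. w \<in> U.fil (Suc i) \<Longrightarrow> R x w - sm f w \<in> U.fil i"
      using R_fil_factor [OF i] by blast
    obtain h where h: "\<And>w. w \<in> U.fil (Suc i) \<Longrightarrow> R z w - sm h w \<in> U.fil i"
      using R_fil_factor [OF i] by blast
    have "(R x (R z w) - sm f (R z w)) + sm f (R z w - sm h w) \<in> U.fil i"
      by (intro U.fil_add U.fil_scale f h R_fil w i)
    moreover have "(R z (R x w) - sm h (R x w)) + sm h (R x w - sm f w) \<in> U.fil i"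
      by (intro U.fil_add U.fil_scale f h R_fil w i)
    ultimately have "((R x (R z w) - sm f (R z w)) + sm f (R z w - sm h w)) -
        ((R z (R x w) - sm h (R x w)) + sm h (R x w - sm f w)) \<in> U.fil i"
      by (rule U.fil_diff)
    then show ?thesis by (simp add: R_br U.scale_right_diff_distrib mult.commute)
  qed
  have "x \<in> span {br x z | x z. x \<in> UNIV \<and> z \<in> UNIV}"
    using x unfolding nil_ideal_eq bracket_def .
  then show ?thesis
  proof (induction rule: span_induct_alt)
    case base
    then show ?case using R_scale_left [of 0 0 w] by (simp add: U.zero_in_fil)
  next
    case (step c x z)
    then show ?case
      using comm by (auto simp: R_add_left R_scale_left restrict_scale_def intro!: U.fil_add U.fil_scale)
  qed
qed

text \<open>In small characteristic \<open>v\<close> also acts through some powers \<open>T ^^ k\<close> with \<open>k > 1\<close>.\<close>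

lemma R_v_fil:
  assumes i: "Suc (Suc i) \<le> m" and w: "w \<in> U.fil (Suc (Suc i))"
  shows "R v w - U.T w \<in> U.fil i"
proof -
  define K where "K = {k. k < m \<and> of_nat k = (1 :: 'f)}"
  have K: "finite K" "1 \<in> K" using i by (auto simp: K_def)
  have "R v w = (\<Sum>k\<in>K. U.at_E (g k v) ((U.T ^^ k) w))"
    by (simp add: R_weight [OF v_weight] wt_op_def K_def)
  also have "\<dots> = U.T w + (\<Sum>k\<in>K - {1}. U.at_E (g k v) ((U.T ^^ k) w))"
    using K by (simp add: sum.remove g_v [simplified] U.at_E_1)
  finally have "R v w - U.T w = (\<Sum>k\<in>K - {1}. U.at_E (g k v) ((U.T ^^ k) w))" by simp
  also have "\<dots> \<in> U.fil i"
  proof (rule U.fil_sum)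
    fix k assume "k \<in> K - {1}"
    moreover have "0 \<notin> K" by (simp add: K_def)
    ultimately have "Suc (Suc i) - k \<le> i" by (cases "k = 0") auto
    then show "U.at_E (g k v) ((U.T ^^ k) w) \<in> U.fil i"
      using U.T_power_fil [OF w i, of k] U.fil_mono [of "Suc (Suc i) - k" i] U.at_E_fil i by auto
  qed
  finally show ?thesis .
qed

lemma R_v_fil_strict:
  assumes i: "Suc (Suc i) \<le> m" and w: "w \<in> U.fil (Suc (Suc i))" and v: "R v w \<in> U.fil i"
  shows "w \<in> U.fil (Suc i)"
proof (rule U.T_fil_strict [OF i w])
  show "U.T w \<in> U.fil i"
    using U.fil_diff [OF v R_v_fil [OF i w]] by simp
qed

text \<open>One inclusion holds because \<open>nil_ideal\<close> lowers the filtration. For the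
  other, \<open>v\<close> alone suffices: if the least \<open>j\<close> with
  \<open>w \<in> fil j\<close> exceeded \<open>i + 1\<close>, then
  \<open>R v w \<in> fil i \<subseteq> fil (j - 2)\<close> would put \<open>w\<close> into
  \<open>fil (j - 1)\<close> by injectivity on factors.\<close>

lemma nil_series_eq: "i \<le> m \<Longrightarrow> nil_series i = U.fil i"
proof (induction i)
  case 0
  then show ?case by (simp add: U.fil_0)
next
  case (Suc i)
  have "w \<in> U.fil (Suc i)" if v: "R v w \<in> U.fil i" for w
  proof (rule ccontr)
    assume nw: "w \<notin> U.fil (Suc i)"
    define j where "j = (LEAST j. w \<in> U.fil j)"
    have j: "w \<in> U.fil j" unfolding j_def by (rule LeastI [of _ m]) (simp add: U.fil_m)
    have "j \<le> m" unfolding j_def by (rule Least_le) (simp add: U.fil_m)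
    have "Suc i < j" using nw j U.fil_mono [of j "Suc i"] by (meson not_le subsetD)
    then obtain l where l: "j = Suc (Suc l)" using that [of "j - 2"] by simp
    have "R v w \<in> U.fil l" using v U.fil_mono [of i l] \<open>Suc i < j\<close> l by auto
    then have "w \<in> U.fil (Suc l)" using R_v_fil_strict j l \<open>j \<le> m\<close> by blast
    then have "j \<le> Suc l" unfolding j_def by (rule Least_le)
    then show False using l by simp
  qed
  then show ?case using Suc R_nil_ideal_fil [of i] v_nil_ideal by auto
qed

lemma nilpotency_length_m: "nilpotency_length m"
  unfolding nilpotency_length_def
proof (intro conjI allI impI)
  show "nil_series m = UNIV" by (simp add: nil_series_eq U.fil_m)
  fix i assume "i < m"
  then show "nil_series i \<subset> nil_series (Suc i)"
    by (simp only: nil_series_eq U.fil_strict Suc_leI less_imp_le_nat)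
qed

lemma admissible: admissible
proof -
  have "u 1 \<noteq> 0" using U.u_nz [of 1] U.m_gt_1 by simp
  then have "(UNIV :: 'u set) \<noteq> {0}" by blast
  moreover have "(R x ^^ k) w \<in> U.fil (m - k)" if "x \<in> nil_ideal" "k \<le> m" for x k w
    using that(2)
  proof (induction k)
    case 0
    then show ?case by (simp add: U.fil_m)
  next
    case (Suc k)
    then show ?case using R_nil_ideal_fil [of "m - Suc k" "(R x ^^ k) w" x] that(1)
      by (simp add: Suc_diff_Suc)
  qed
  then have "(R x ^^ m) w = 0" if "x \<in> nil_ideal" for x w
    using that by (metis U.fil_0 diff_self_eq_0 order_refl singletonD)
  ultimately show ?thesis unfolding admissible_def by blast
qed

end

section \<open>Uniseriality\<close>

context graded_rep
begin

lemma coset_eq_iff: "w' +o U.fil i = w +o U.fil i \<longleftrightarrow> w' - w \<in> U.fil i"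
proof
  assume "w' +o U.fil i = w +o U.fil i"
  then have "w' \<in> w +o U.fil i"
    using set_plus_intro2 [OF U.zero_in_fil, of w' i] by simp
  then show "w' - w \<in> U.fil i" by (rule set_plus_imp_minus)
next
  assume ww1: "w' - w \<in> U.fil i"
  then have ww2: "w - w' \<in> U.fil i" using U.fil_minus by fastforce
  have "x \<in> w' +o U.fil i \<longleftrightarrow> x \<in> w +o U.fil i" for x
  proof -
    have "x - w = (x - w') + (w' - w)" "x - w' = (x - w) + (w - w')" by simp_all
    then show ?thesis using ww1 ww2 U.fil_add unfolding set_minus_plus [symmetric] by metis
  qed
  then show "w' +o U.fil i = w +o U.fil i" by blast
qed

lemma factor_module_add: "(w' +o U.fil i) + (w +o U.fil i) = (w' + w) +o U.fil i"
proof -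
  have "U.fil i + U.fil i = U.fil i"
  proof
    show "U.fil i + U.fil i \<subseteq> U.fil i" using U.fil_add by (auto simp: set_plus_def)
  qed (rule set_zero_plus2 [OF U.zero_in_fil])
  then show ?thesis by (simp add: set_plus_rearrange)
qed

lemma factor_module_scale:
  "restrict_scale sm c ` (w +o U.fil i) + U.fil i = restrict_scale sm c w +o U.fil i"
proof
  show "restrict_scale sm c ` (w +o U.fil i) + U.fil i \<subseteq> restrict_scale sm c w +o U.fil i"
    by (auto simp: elt_set_plus_def set_plus_def restrict_scale_def U.scale_right_distrib add.assoc
        U.fil_add U.fil_scale)
  show "restrict_scale sm c w +o U.fil i \<subseteq> restrict_scale sm c ` (w +o U.fil i) + U.fil i"
    using U.zero_in_fil [of i] by (force simp: elt_set_plus_def set_plus_def)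
qed

text \<open>The action on cosets is well defined: changing \<open>z\<close> by an element of
  \<open>nil_ideal\<close> or \<open>w\<close> by one of \<open>fil i\<close> changes the result
  within \<open>fil i\<close>.\<close>

lemma factor_module_act:
  assumes i: "Suc i \<le> m" and w: "w \<in> U.fil (Suc i)"
  shows "{R x w' | x w'. x \<in> z +o nil_ideal \<and> w' \<in> w +o U.fil i} + U.fil i = R z w +o U.fil i"
    (is "?L = ?R")
proof
  show "?L \<subseteq> ?R"
  proof
    fix t assume "t \<in> ?L"
    then obtain n a b where t: "t = R (z + n) (w + a) + b" "n \<in> nil_ideal" "a \<in> U.fil i" "b \<in> U.fil i"
      by (auto simp: elt_set_plus_def set_plus_def)
    have "R n w + R (z + n) a + b \<in> U.fil i"
      using t R_nil_ideal_fil [OF i w] R_fil i by (intro U.fil_add) auto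
    moreover have "t = R z w + (R n w + R (z + n) a + b)"
      by (simp add: t(1) R_add_left R_add_right algebra_simps)
    ultimately show "t \<in> ?R" by (auto simp: elt_set_plus_def)
  qed
  show "?R \<subseteq> ?L"
  proof
    fix t assume "t \<in> ?R"
    then obtain b where t: "t = R z w + b" "b \<in> U.fil i" by (auto simp: elt_set_plus_def)
    have "0 \<in> nil_ideal" unfolding nil_ideal_eq bracket_def by (rule span_zero)
    then have "z \<in> z +o nil_ideal" using set_plus_intro2 [of 0 nil_ideal z] by simp
    moreover have "w \<in> w +o U.fil i" using set_plus_intro2 [OF U.zero_in_fil, of w i] by simp
    ultimately show "t \<in> ?L" unfolding t(1) using t(2) by (intro set_plus_intro) blast+
  qed
qed

text \<open>The factor is generated over \<open>F[X]\<close> by the coset of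
  \<open>u (Suc i)\<close>, with \<open>y\<close> acting as \<open>X\<close>. So submodules are
  determined by their ideals of coefficients, all of which contain \<open>q (Suc i)\<close>, and
  such ideals form a chain.\<close>

lemma uniserial_factor:
  assumes i: "Suc i \<le> m"
  shows "uniserial (factor_module (U.fil (Suc i)) (U.fil i))" (is "uniserial ?M")
  unfolding uniserial_def
proof (intro conjI allI impI)
  let ?u = "u (Suc i)" and ?V = "U.fil i"
  have u_in: "sm f ?u \<in> U.fil (Suc i)" for f by (rule U.generator_in_fil) auto
  obtain w where w: "w \<in> U.fil (Suc i)" "w \<notin> ?V" using U.fil_strict [OF i] by blast
  then have "w +o ?V \<noteq> 0 +o ?V" unfolding coset_eq_iff by simp
  then show "mcarrier ?M \<noteq> {mzero ?M}" using w(1) by (auto simp: factor_module_def)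
  fix W1 W2 assume W: "lie_submodule ?M W1 \<and> lie_submodule ?M W2"
  \<comment> \<open>The coefficient ideal of a submodule: closure under \<open>y\<close> gives
    closure under multiplication by \<open>X\<close>, hence by every polynomial.\<close>
  define P where "P W = {f. sm f ?u +o ?V \<in> W}" for W
  have P_add: "f + h \<in> P W" if W: "lie_submodule ?M W" and "f \<in> P W" "h \<in> P W" for f h W
  proof -
    have "(sm f ?u +o ?V) + (sm h ?u +o ?V) \<in> W"
      using that unfolding lie_submodule_def P_def factor_module_def by simp
    then show ?thesis by (simp add: P_def factor_module_add U.scale_left_distrib)
  qed
  have P_const: "smult c f \<in> P W" if W: "lie_submodule ?M W" and "f \<in> P W" for c f W
  proof -
    have "restrict_scale sm c ` (sm f ?u +o ?V) + ?V \<in> W"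
      using that unfolding lie_submodule_def P_def factor_module_def by simp
    then show ?thesis by (simp only: factor_module_scale) (simp add: P_def restrict_scale_def)
  qed
  have P_X: "[:0, 1:] * f \<in> P W" if W: "lie_submodule ?M W" and f: "f \<in> P W" for f W
  proof -
    have "mact ?M (y +o nil_ideal) (sm f ?u +o ?V) \<in> W"
      using W f unfolding lie_submodule_def P_def factor_module_def by auto
    then have "R y (sm f ?u) +o ?V \<in> W"
      using factor_module_act [OF i u_in] by (simp add: factor_module_def)
    then show ?thesis by (simp only: R_y op_A_def U.scale_scale P_def mem_Collect_eq)
  qed
  have P_mult: "h * f \<in> P W" if W: "lie_submodule ?M W" and f: "f \<in> P W" for f h W
  proof (induction h)
    case 0
    show ?case using P_const [OF W f, of 0] by simp
  next
    case (pCons c h)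
    have "pCons c h * f = smult c f + [:0, 1:] * (h * f)" by simp
    then show ?case using P_add [OF W P_const [OF W f] P_X [OF W pCons.IH]] by metis
  qed
  have P_q: "U.q (Suc i) \<in> P W" if W: "lie_submodule ?M W" for W
  proof -
    have "sm (U.q (Suc i)) ?u = 0" using U.annihilator [of "Suc i"] i by simp
    then show ?thesis using W unfolding lie_submodule_def P_def factor_module_def by simp
  qed
  have "P W1 \<subseteq> P W2 \<or> P W2 \<subseteq> P W1"
    by (rule poly_ideal_chain [where n = "s (Suc i)", OF irreducible_pp [OF U.irred, of "Suc i"]])
       (use W P_add P_mult P_q in blast)+
  moreover have "W \<subseteq> W'" if W: "lie_submodule ?M W" and le: "P W \<subseteq> P W'" for W W'
  proof
    fix C assume C: "C \<in> W"
    then obtain w where w: "w \<in> U.fil (Suc i)" "C = w +o ?V"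
      using W unfolding lie_submodule_def factor_module_def by auto
    obtain h w' where w': "w = sm h ?u + w'" "w' \<in> ?V" using w(1) by (rule U.fil_Suc_cases)
    then have "C = sm h ?u +o ?V" unfolding w(2) coset_eq_iff by simp
    with C have "h \<in> P W" by (simp add: P_def)
    with le have "h \<in> P W'" by blast
    then show "C \<in> W'" by (simp add: P_def \<open>C = sm h ?u +o ?V\<close>)
  qed
  ultimately show "W1 \<subseteq> W2 \<or> W2 \<subseteq> W1" using W by blast
qed

lemma linked: linked
  unfolding linked_def
proof (intro conjI exI ballI)
  show "uniserial (factor_module (nil_series i) (nil_series (i - 1)))" if "i \<in> {1..m}" for i
  proof -
    have "nil_series i = U.fil i" "nil_series (i - 1) = U.fil (i - 1)"
      using that by (intro nil_series_eq; auto)+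
    then show ?thesis using uniserial_factor [of "i - 1"] that by simp
  qed
qed (rule admissible nilpotency_length_m)+

section \<open>Submodules of the whole module\<close>

lemma self_submodule_iff:
  "lie_submodule self_module W \<longleftrightarrow> 0 \<in> W \<and> (\<forall>v\<in>W. \<forall>w\<in>W. v + w \<in> W) \<and>
     (\<forall>c. \<forall>w\<in>W. sm [:c:] w \<in> W) \<and> (\<forall>x. \<forall>w\<in>W. R x w \<in> W)"
  by (simp add: lie_submodule_def self_module_def restrict_scale_def)

lemma submodule_scale:
  assumes W: "lie_submodule self_module W" and w: "w \<in> W"
  shows "sm f w \<in> W"
proof (induction f)
  case 0
  show ?case using W by (simp add: self_submodule_iff)
next
  case (pCons c f)
  have "R y (sm f w) \<in> W" using W pCons.IH by (simp add: self_submodule_iff)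
  moreover have "sm [:c:] w \<in> W" using W w by (simp add: self_submodule_iff)
  moreover have "sm (pCons c f) w = sm [:c:] w + R y (sm f w)"
    by (simp add: R_y op_A_def U.scale_left_distrib [symmetric])
  ultimately show ?case using W by (simp add: self_submodule_iff)
qed

text \<open>When \<open>s (Suc i) = 1\<close>, the factor \<open>F[X]/(p_(i+1))\<close> is a field,
  so any \<open>w\<close> outside \<open>fil i\<close> generates it: a Bezout relation inverts the
  leading coefficient \<open>h\<close>.\<close>

lemma submodule_contains_fil_step:
  assumes W: "lie_submodule self_module W" and s: "\<forall>i\<in>{1..m}. s i = 1"
    and i: "Suc i \<le> m" and w: "w \<in> W" "w \<in> U.fil (Suc i)" "w \<notin> U.fil i" and le: "U.fil i \<subseteq> W"
  shows "U.fil (Suc i) \<subseteq> W"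
proof -
  let ?p = "pp p1 (Suc i)" and ?u = "u (Suc i)"
  have q: "U.q (Suc i) = ?p" using s i by simp
  obtain h w' where w': "w = sm h ?u + w'" "w' \<in> U.fil i" using w(2) by (rule U.fil_Suc_cases)
  have "\<not> ?p dvd h"
    using w(3) w' U.fil_add U.generator_in_fil_iff [OF i, of h] unfolding q by blast
  then obtain a b where ab: "a * ?p + b * h = 1"
    using irreducible_bezout [OF irreducible_pp [OF U.irred]] by blast
  have "sm ?p ?u = 0" using U.annihilator [of "Suc i" ?p] i q by simp
  then have "sm (a * ?p + b * h) ?u = sm (b * h) ?u"
    by (simp only: U.scale_left_distrib U.scale_scale [symmetric] U.scale_zero_right add_0)
  then have bw: "sm b w = ?u + sm b w'" unfolding ab by (simp add: w'(1) U.scale_right_distrib)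
  show "U.fil (Suc i) \<subseteq> W"
  proof
    fix x assume "x \<in> U.fil (Suc i)"
    then obtain k x' where x: "x = sm k ?u + x'" "x' \<in> U.fil i" by (rule U.fil_Suc_cases)
    have "x = sm k (sm b w) + (x' - sm k (sm b w'))"
      unfolding bw by (simp add: x(1) U.scale_right_distrib)
    moreover have "sm k (sm b w) \<in> W" by (intro submodule_scale W w)
    moreover have "x' - sm k (sm b w') \<in> W"
      using le U.fil_diff [OF x(2) U.fil_scale [OF U.fil_scale [OF w'(2)]]] by blast
    ultimately show "x \<in> W" using W by (simp add: self_submodule_iff)
  qed
qed

text \<open>Applying \<open>v\<close> to an element at one level of the filtration gives one at
  exactly the level below, by injectivity on factors. So the lower terms come from the induction
  hypothesis.\<close>

lemma submodule_contains_fil: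
  assumes W: "lie_submodule self_module W" and s: "\<forall>i\<in>{1..m}. s i = 1"
  shows "Suc i \<le> m \<Longrightarrow> w \<in> W \<Longrightarrow> w \<in> U.fil (Suc i) \<Longrightarrow> w \<notin> U.fil i \<Longrightarrow> U.fil (Suc i) \<subseteq> W"
proof (induction i arbitrary: w)
  case 0
  have "U.fil 0 \<subseteq> W" using W by (simp add: U.fil_0 self_submodule_iff)
  with 0 show ?case by (rule submodule_contains_fil_step [OF W s])
next
  case (Suc i)
  have "R v w \<in> W" using W Suc.prems by (simp add: self_submodule_iff)
  moreover have "R v w \<in> U.fil (Suc i)"
    using R_nil_ideal_fil [OF Suc.prems(1,3) v_nil_ideal] .
  moreover have "R v w \<notin> U.fil i" using R_v_fil_strict Suc.prems by blast
  ultimately have "U.fil (Suc i) \<subseteq> W" using Suc.IH Suc.prems(1) by simp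
  with Suc.prems show ?case by (rule submodule_contains_fil_step [OF W s])
qed

lemma self_module_uniserial:
  assumes s: "\<forall>i\<in>{1..m}. s i = 1"
  shows "uniserial self_module"
  unfolding uniserial_def
proof (intro conjI allI impI)
  have "(UNIV :: 'u set) \<noteq> {0}" using admissible unfolding admissible_def by blast
  then show "mcarrier self_module \<noteq> {mzero self_module}" by (simp add: self_module_def)
  \<comment> \<open>The term is the least \<open>fil i\<close> containing \<open>W\<close>;
    minimality provides an element of \<open>W\<close> outside \<open>fil (i - 1)\<close>, which
    forces all of \<open>fil i\<close> into \<open>W\<close>.\<close>
  have is_fil: "\<exists>i. W = U.fil i" if W: "lie_submodule self_module W" for W
  proof -
    define i where "i = (LEAST i. W \<subseteq> U.fil i)"
    have i: "W \<subseteq> U.fil i" unfolding i_def by (rule LeastI [of _ m]) (simp add: U.fil_m)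
    have "i \<le> m" unfolding i_def by (rule Least_le) (simp add: U.fil_m)
    have "U.fil i \<subseteq> W"
    proof (cases i)
      case 0
      then show ?thesis using W by (simp add: U.fil_0 self_submodule_iff)
    next
      case (Suc j)
      then have "\<not> W \<subseteq> U.fil j" unfolding i_def using not_less_Least by (metis lessI)
      then obtain w where "w \<in> W" "w \<notin> U.fil j" by blast
      then show ?thesis using submodule_contains_fil [OF W s, of j w] i Suc \<open>i \<le> m\<close> by blast
    qed
    with i show ?thesis by blast
  qed
  fix W1 W2 assume "lie_submodule self_module W1 \<and> lie_submodule self_module W2"
  then obtain i k where "W1 = U.fil i" "W2 = U.fil k" using is_fil by blast
  then show "W1 \<subseteq> W2 \<or> W2 \<subseteq> W1" using U.fil_mono [of i k] U.fil_mono [of k i] nat_le_linear by blast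
qed

text \<open>If \<open>s 1 > 1\<close>, the submodule generated by the socle element \<open>z\<close> of the second summand is
  incomparable with the first summand.\<close>

lemma self_module_not_uniserial:
  assumes s1: "s 1 > 1"
  shows "\<not> uniserial self_module"
proof
  assume uni: "uniserial self_module"
  define z where "z = sm (pp p1 2 ^ (s 2 - 1)) (u 2)"
  \<comment> \<open>This is \<open>T z\<close>, as \<open>(s 2 - 1) + (s 1 - s 2) = s 1 - 1\<close>;
    including its multiples makes \<open>W\<close> stable under the algebra.\<close>
  define z' where "z' = sm (p1 ^ (s 1 - 1)) (u 1)"
  define W where "W = {sm f z + sm h z' | f h. True}"
  have m2: "2 \<le> m" using U.m_gt_1 by simp
  have s2: "s 2 > 0" "s 2 \<le> s 1" using U.s_pos [of 2] U.s_antimono [of 1 2] m2 by auto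
  have W_add: "v + w \<in> W" if vw: "v \<in> W" "w \<in> W" for v w
  proof -
    obtain f h f' h' where "v = sm f z + sm h z'" "w = sm f' z + sm h' z'"
      using vw unfolding W_def by blast
    then have "v + w = sm (f + f') z + sm (h + h') z'" by (simp add: U.scale_left_distrib)
    then show ?thesis unfolding W_def by blast
  qed
  have W_scale: "sm f w \<in> W" if "w \<in> W" for f w
    using that unfolding W_def by (auto simp: U.scale_right_distrib) blast
  have W_0: "0 \<in> W" unfolding W_def by (auto intro!: exI [of _ 0])
  have W_sum: "sum F I \<in> W" if "\<And>k. k \<in> I \<Longrightarrow> F k \<in> W" for F and I :: "nat set"
    using that by (induction I rule: infinite_finite_induct) (auto simp: W_0 W_add)
  have z_in: "sm f z \<in> W" "sm f z' \<in> W" for f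
  proof -
    have "sm f z = sm f z + sm 0 z'" "sm f z' = sm 0 z + sm f z'" by simp_all
    then show "sm f z \<in> W" "sm f z' \<in> W" unfolding W_def by blast+
  qed
  have T_z: "U.T z = z'"
  proof -
    have "U.T z = sm (U.down 1 (pp p1 2 ^ (s 2 - 1))) (U.T (u 2))"
      using U.T_semilinear unfolding semilinear_def z_def by blast
    also have "\<dots> = sm (p1 ^ (s 2 - 1) * p1 ^ (s 1 - s 2)) (u 1)"
      using U.T_u [of 2] translate_pp [of 1 2 p1] m2 by (simp add: translate_power)
    also have "p1 ^ (s 2 - 1) * p1 ^ (s 1 - s 2) = p1 ^ (s 1 - 1)"
      using s2 by (simp add: power_add [symmetric])
    finally show ?thesis by (simp add: z'_def)
  qed
  have "U.T z' = 0" using U.T_semilinear U.T_u_1 by (simp add: semilinear_def z'_def)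
  have T_W: "U.T w \<in> W" if w: "w \<in> W" for w
  proof -
    obtain f h where "w = sm f z + sm h z'" using w unfolding W_def by blast
    then have "U.T w = sm (U.down 1 f) z'"
      using U.T_semilinear T_z \<open>U.T z' = 0\<close> by (simp add: semilinear_def)
    then show ?thesis by (simp add: z_in)
  qed
  have T_power_W: "(U.T ^^ k) w \<in> W" if "w \<in> W" for k w
    using that by (induction k) (auto intro: T_W)
  have at_E_W: "U.at_E f w \<in> W" if w: "w \<in> W" for f w
  proof -
    have "U.at_E f z = sm (translate_poly f 1) z" "U.at_E f z' = sm f z'"
      using U.at_E_u [of 2 f] U.at_E_u [of 1 f] m2
      by (simp_all add: z_def z'_def U.at_E_scale mult.commute)
    moreover obtain f' h' where "w = sm f' z + sm h' z'" using w unfolding W_def by blast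
    ultimately show ?thesis by (simp add: U.at_E_plus U.at_E_scale W_add z_in)
  qed
  have R_W: "R x w \<in> W" if w: "w \<in> W" for x w
  proof (induction x rule: weight_induct)
    case (2 \<gamma> x)
    then show ?case by (simp add: R_weight wt_op_def W_sum at_E_W T_power_W w)
  qed (simp_all add: R_y op_A_def R_add_left R_scale_left restrict_scale_def W_add W_scale w)
  have "lie_submodule self_module W"
    by (simp add: self_submodule_iff W_0 W_add W_scale R_W)
  moreover have "lie_submodule self_module (U.fil 1)"
    using U.m_gt_1 by (simp add: self_submodule_iff U.zero_in_fil U.fil_add U.fil_scale R_fil)
  ultimately consider "W \<subseteq> U.fil 1" | "U.fil 1 \<subseteq> W" using uni unfolding uniserial_def by blast
  then show False
  proof cases
    case 1
    then have "z \<in> U.fil 1" using z_in(1) [of 1] by auto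
    then have "U.q 2 dvd pp p1 2 ^ (s 2 - 1)"
      using U.generator_in_fil_iff [of 1] m2 by (simp add: z_def numeral_2_eq_2)
    then show False using s2 U.p1_not_unit(2) [of 2] U.pp_nz by (simp add: dvd_power_iff)
  next
    case 2
    have "u 1 \<in> U.fil 1" using U.generator_in_fil [of 1 1 1] by simp
    then obtain f h where u1: "u 1 = sm f z + sm h z'" using 2 unfolding W_def by blast
    \<comment> \<open>The component of \<open>u 1\<close> in the second summand vanishes, so
      \<open>u 1\<close> would be the multiple \<open>h\<close> of \<open>z'\<close>. As
      \<open>s 1 > 1\<close>, both \<open>p1 ^ s 1\<close> and \<open>p1 ^ (s 1 - 1)\<close> are
      divisible by \<open>p1\<close>, which would then divide 1.\<close>
    have "sm h z' \<in> U.fil 1" unfolding z'_def by (intro U.fil_scale U.generator_in_fil) auto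
    then have "sm f z \<in> U.fil 1" using \<open>u 1 \<in> U.fil 1\<close> U.fil_add_cancel u1 by metis
    then have "U.q 2 dvd f * pp p1 2 ^ (s 2 - 1)"
      using U.generator_in_fil_iff [of 1] m2 by (simp add: z_def numeral_2_eq_2)
    then have "sm f z = 0" using U.annihilator [of 2] m2 by (simp add: z_def)
    then have "sm (1 - h * p1 ^ (s 1 - 1)) (u 1) = 0"
      using u1 by (simp add: z'_def U.scale_left_diff_distrib)
    then have "p1 ^ s 1 dvd 1 - h * p1 ^ (s 1 - 1)"
      using U.annihilator [of 1] m2 by simp
    moreover have "p1 dvd p1 ^ s 1" "p1 dvd h * p1 ^ (s 1 - 1)" using s1 by (simp_all add: dvd_power)
    ultimately have "p1 dvd (1 - h * p1 ^ (s 1 - 1)) + h * p1 ^ (s 1 - 1)"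
      by (meson dvd_add dvd_trans)
    then show False using U.p1_not_unit(1) by simp
  qed
qed

lemma uniserial_iff: "uniserial self_module \<longleftrightarrow> (\<forall>i\<in>{1..m}. s i = 1)"
proof
  assume "uniserial self_module"
  then have "s 1 \<le> 1" using self_module_not_uniserial by force
  show "\<forall>i\<in>{1..m}. s i = 1"
  proof
    fix i assume "i \<in> {1..m}"
    then show "s i = 1" using U.s_pos [of i] U.s_antimono [of 1 i] \<open>s 1 \<le> 1\<close> by force
  qed
qed (rule self_module_uniserial)

lemma R_weight_large_char:
  assumes char: "CHAR('f) \<noteq> 0 \<longrightarrow> m \<le> CHAR('f)" and j: "j < m"
    and x: "x \<in> weight_space y a (of_nat j)"
  shows "R x w = U.at_E (g j x) ((U.T ^^ j) w)"
proof -
  have "{k. k < m \<and> of_nat k = (of_nat j :: 'f)} = {j}"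
    using of_nat_inj_below_char [OF char] j by blast
  then show ?thesis by (simp add: R_weight [OF x] wt_op_def)
qed

end

section \<open>Equivalence of representations\<close>

text \<open>The contrapositive of the last claim. The two modules may live on different types, so
  all comparisons go through \<open>\<phi>\<close>.\<close>

lemma equivalent_imp_same_data:
  fixes hs :: "'f::field \<Rightarrow> 'h::ab_group_add \<Rightarrow> 'h"
    and sm :: "'f poly \<Rightarrow> 'u::ab_group_add \<Rightarrow> 'u" and sm' :: "'f poly \<Rightarrow> 'w::ab_group_add \<Rightarrow> 'w"
  assumes rep: "graded_rep hs br y v a m p1 s g sm u" and rep': "graded_rep hs br y v a m' p1' s' g' sm' u'"
    and char: "CHAR('f) \<noteq> 0 \<longrightarrow> CHAR('f) \<ge> m \<and> {\<gamma>. translate_poly p1 \<gamma> = p1} = {0}"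
    and equiv: "equivalent_reps (restrict_scale sm) (lie_algebra.rep_R hs br y a sm m p1 s u g)
       (restrict_scale sm') (lie_algebra.rep_R hs br y a sm' m' p1' s' u' g')"
  shows "m' = m \<and> p1' = p1 \<and> (\<forall>i\<in>{1..m}. s' i = s i) \<and>
     (\<forall>j<m. \<forall>x\<in>lie_algebra.weight_space hs br y a (of_nat j). g' j x = g j x)"
proof -
  interpret X: graded_rep hs br y v a m p1 s g sm u by (rule rep)
  interpret X': graded_rep hs br y v a m' p1' s' g' sm' u' by (rule rep')
  obtain \<phi> where lin: "Vector_Spaces.linear (restrict_scale sm) (restrict_scale sm') \<phi>"
    and bij: "bij \<phi>" and hom: "\<And>x w. \<phi> (X.R x w) = X'.R x (\<phi> w)"
    using equiv unfolding equivalent_reps_def by blast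
  have add: "\<phi> (w + w') = \<phi> w + \<phi> w'" for w w' using lin by (simp add: Vector_Spaces.linear_iff)
  have zero: "\<phi> 0 = 0" using add [of 0 0] by (metis add_cancel_right_right)
  have sum: "\<phi> (sum F I) = (\<Sum>i\<in>I. \<phi> (F i))" for F and I :: "nat set"
    by (induction I rule: infinite_finite_induct) (simp_all add: add zero)
  have eq_0: "\<phi> w = 0 \<longleftrightarrow> w = 0" for w using bij zero by (metis bij_pointE)
  have all_image: "(\<forall>w. P w) \<longleftrightarrow> (\<forall>w. P (\<phi> w))" for P using bij by (metis bij_pointE)
  have scale: "\<phi> (sm f w) = sm' f (\<phi> w)" for f w
  proof (induction f)
    case 0
    show ?case by (simp add: zero)
  next
    case (pCons c f)
    have "\<phi> (sm [:c:] w) = sm' [:c:] (\<phi> w)"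
      using lin by (simp add: Vector_Spaces.linear_iff restrict_scale_def)
    moreover have "\<phi> (sm [:0, 1:] (sm f w)) = sm' [:0, 1:] (sm' f (\<phi> w))"
      using hom [of y "sm f w"] pCons.IH by (simp add: X.R_y X'.R_y op_A_def)
    moreover have "sm (pCons c f) w = sm [:c:] w + sm [:0, 1:] (sm f w)"
      by (simp add: X.U.scale_left_distrib [symmetric])
    moreover have "sm' (pCons c f) (\<phi> w) = sm' [:c:] (\<phi> w) + sm' [:0, 1:] (sm' f (\<phi> w))"
      by (simp add: X'.U.scale_left_distrib [symmetric])
    ultimately show ?case by (simp only: add)
  qed
  have series: "\<phi> w \<in> X'.nil_series i \<longleftrightarrow> w \<in> X.nil_series i" for i w
    by (induction i arbitrary: w) (simp_all add: eq_0 hom [symmetric])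
  have series_UNIV: "X'.nil_series i = UNIV \<longleftrightarrow> X.nil_series i = UNIV" for i
    using series [of _ i] bij by (metis UNIV_I UNIV_eq_I bij_pointE)
  have len: "X.nil_series m = UNIV" "X'.nil_series m' = UNIV"
    "\<And>i. i < m \<Longrightarrow> X.nil_series i \<noteq> UNIV" "\<And>i. i < m' \<Longrightarrow> X'.nil_series i \<noteq> UNIV"
    using X.nilpotency_length_m X'.nilpotency_length_m
    unfolding X.nilpotency_length_def X'.nilpotency_length_def by blast+
  then have m': "m' = m" using series_UNIV by (metis linorder_neqE_nat)
  have fil: "\<phi> w \<in> X'.U.fil i \<longleftrightarrow> w \<in> X.U.fil i" if "i \<le> m" for i w
    using series [of w i] X.nil_series_eq [OF that] X'.nil_series_eq [of i] that m' by simp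
  have q_eq: "X.U.q (Suc i) = X'.U.q (Suc i)" if i: "Suc i \<le> m" for i
  proof -
    have "X.U.q (Suc i) dvd f \<longleftrightarrow> X'.U.q (Suc i) dvd f" for f
    proof -
      have "(\<forall>w\<in>X.U.fil (Suc i). sm f w \<in> X.U.fil i) \<longleftrightarrow>
          (\<forall>w\<in>X'.U.fil (Suc i). sm' f w \<in> X'.U.fil i)"
      proof -
        have "(\<forall>w\<in>X'.U.fil (Suc i). sm' f w \<in> X'.U.fil i) \<longleftrightarrow>
            (\<forall>w. \<phi> w \<in> X'.U.fil (Suc i) \<longrightarrow> sm' f (\<phi> w) \<in> X'.U.fil i)"
          using all_image [of "\<lambda>w. w \<in> X'.U.fil (Suc i) \<longrightarrow> sm' f w \<in> X'.U.fil i"] by blast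
        also have "\<dots> \<longleftrightarrow> (\<forall>w\<in>X.U.fil (Suc i). sm f w \<in> X.U.fil i)"
          unfolding scale [symmetric] fil [OF i] fil [OF Suc_leD [OF i]] by blast
        finally show ?thesis by blast
      qed
      then show ?thesis using X.U.fil_annihilator [OF i] X'.U.fil_annihilator [of i] i m' by simp
    qed
    then have "X.U.q (Suc i) dvd X'.U.q (Suc i)" "X'.U.q (Suc i) dvd X.U.q (Suc i)"
      by (metis dvd_refl)+
    then show ?thesis
      by (intro monic_dvd_eq) (simp_all add: lead_coeff_power lead_coeff_pp X.U.monic X'.U.monic del: degree_pp)
  qed
  \<comment> \<open>The lowest factor suffices for \<open>p1\<close>, since no translation occurs at
    index 1; the exponents then follow by comparing degrees.\<close>
  have "p1 ^ s 1 = p1' ^ s' 1" using q_eq [of 0] X.U.m_gt_1 by simp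
  moreover have "p1 dvd p1 ^ s 1" using X.U.s_pos [of 1] X.U.m_gt_1 by (simp add: dvd_power)
  ultimately have "p1 dvd p1'" using irreducible_dvd_power [OF X.U.irred] by simp
  then have p1': "p1' = p1"
    using monic_irreducible_dvd_eq [OF X.U.irred X'.U.irred] X.U.monic X'.U.monic by simp
  have s': "s' i = s i" if i: "i \<in> {1..m}" for i
  proof -
    have "degree (X.U.q i) = degree (X'.U.q i)" using q_eq [of "i - 1"] i by simp
    then have "s i * degree p1 = s' i * degree p1"
      using degree_monic_power [of "pp p1 i"] X.U.monic lead_coeff_pp [of p1 i] by (simp add: p1')
    then show ?thesis using X.U.degree_p1 by simp
  qed
  have pp_distinct: "i = k" if ik: "i \<in> {1..m}" "k \<in> {1..m}" and eq: "pp p1 i = pp p1 k" for i k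
  proof -
    have "translate_poly (pp p1 i) (- of_nat (k - 1)) = translate_poly (pp p1 k) (- of_nat (k - 1))"
      by (simp only: eq)
    then have "translate_poly p1 (of_nat (i - 1) - of_nat (k - 1)) = p1"
      unfolding pp_def translate_translate by simp
    \<comment> \<open>In prime characteristic this is the trivial stabilizer, in characteristic 0
      the result on translation-invariant polynomials.\<close>
    then have "(of_nat (i - 1) :: 'f) - of_nat (k - 1) = 0"
      using translate_fixed_char_0 [of p1] X.U.degree_p1 char by blast
    then have "i - 1 = k - 1"
      using of_nat_inj_below_char [where ?'f = 'f and m = m and i = "i - 1" and k = "k - 1"] char ik
      by force
    then show ?thesis using ik by auto
  qed
  have \<phi>_u: "\<exists>c. \<phi> (u i) = sm' c (u' i)" if i: "i \<in> {1..m}" for i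
  proof -
    obtain c where c: "\<phi> (u i) = (\<Sum>k=1..m. sm' (c k) (u' k))"
      using X'.U.coordinates m' by blast
    have "sm (X.U.q i) (u i) = 0" using X.U.annihilator [OF i] by simp
    then have "sm' (X.U.q i) (\<phi> (u i)) = 0" using scale zero by metis
    then have 0: "(\<Sum>k=1..m. sm' (X.U.q i * c k) (u' k)) = 0"
      by (simp add: c X'.U.scale_sum_right)
    \<comment> \<open>\<open>q i\<close> kills \<open>u i\<close>, hence every component of
      \<open>\<phi> (u i)\<close>; for \<open>k \<noteq> i\<close> so does \<open>q k\<close>, which
      is coprime to \<open>q i\<close> because the \<open>p_i\<close> are distinct.\<close>
    have "sm' (c k) (u' k) = 0" if k: "k \<in> {1..m}" "k \<noteq> i" for k
    proof -
      have "sm' (X.U.q i * c k) (u' k) = 0"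
        using X'.U.coordinates_0 [where c = "\<lambda>k. X.U.q i * c k"] 0 k m' by blast
      then have dvd: "X'.U.q k dvd X.U.q i * c k" using X'.U.annihilator k m' by blast
      have "\<not> pp p1 k dvd X.U.q i"
      proof
        assume "pp p1 k dvd X.U.q i"
        then have "pp p1 k dvd pp p1 i"
          using irreducible_dvd_power [OF irreducible_pp [OF X.U.irred]] by blast
        then have "pp p1 k = pp p1 i"
          by (intro monic_irreducible_dvd_eq irreducible_pp X.U.irred)
             (simp_all add: lead_coeff_pp X.U.monic del: degree_pp)
        then show False using pp_distinct i k by blast
      qed
      then obtain a b where ab: "a * pp p1 k ^ s' k + b * X.U.q i = 1"
        using irreducible_power_bezout [OF irreducible_pp [OF X.U.irred]] by blast
      have "c k = c k * (a * pp p1 k ^ s' k + b * X.U.q i)" by (simp add: ab)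
      also have "\<dots> = (a * c k) * X'.U.q k + b * (X.U.q i * c k)" by (simp add: p1' algebra_simps)
      also have "X'.U.q k dvd \<dots>" using dvd by simp
      finally show ?thesis using X'.U.annihilator k m' by blast
    qed
    then have "\<phi> (u i) = (\<Sum>k=1..m. if k = i then sm' (c k) (u' k) else 0)"
      unfolding c by (intro sum.cong) auto
    then show ?thesis using i by auto
  qed
  have \<phi>_at_E: "\<phi> (X.U.at_E f w) = X'.U.at_E f (\<phi> w)" for f w
  proof -
    have "\<phi> (X.U.at_E f (u i)) = X'.U.at_E f (\<phi> (u i))" if i: "i \<in> {1..m}" for i
    proof -
      obtain c where c: "\<phi> (u i) = sm' c (u' i)" using \<phi>_u [OF i] by blast
      have "X'.U.at_E f (u' i) = sm' (translate_poly f (of_nat (i - 1))) (u' i)"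
        using i m' by (intro X'.U.at_E_u) simp
      then show ?thesis
        unfolding X.U.at_E_u [OF i] scale c X'.U.at_E_scale by (simp add: mult.commute)
    qed
    moreover obtain c where w: "w = (\<Sum>i=1..m. sm (c i) (u i))" using X.U.coordinates by blast
    ultimately show ?thesis
      unfolding w X.U.semilinear_sum [OF X.U.at_E_semilinear] sum X'.U.semilinear_sum [OF X'.U.at_E_semilinear]
      by (intro sum.cong) (auto simp: X.U.at_E_scale X'.U.at_E_scale scale)
  qed
  have weight_v: "v \<in> X.weight_space y a (of_nat 1)" using X.v_weight by simp
  have chars: "CHAR('f) \<noteq> 0 \<longrightarrow> m \<le> CHAR('f)" "CHAR('f) \<noteq> 0 \<longrightarrow> m' \<le> CHAR('f)"
    using char m' by blast+
  \<comment> \<open>Now that weights are distinct, \<open>v\<close> acts as \<open>T\<close>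
    exactly, because \<open>g 1 v = 1\<close>.\<close>
  have \<phi>_T: "\<phi> (X.U.T w) = X'.U.T (\<phi> w)" for w
    using hom [of v w] X.R_weight_large_char [OF chars(1) X.U.m_gt_1 weight_v, of w]
      X'.R_weight_large_char [OF chars(2) X'.U.m_gt_1 weight_v, of "\<phi> w"]
    by (simp add: X.g_v [simplified] X'.g_v [simplified] X.U.at_E_1 X'.U.at_E_1)
  have \<phi>_T_power: "\<phi> ((X.U.T ^^ k) w) = (X'.U.T ^^ k) (\<phi> w)" for k w
    by (induction k) (simp_all add: \<phi>_T)
  have "g' j x = g j x" if j: "j < m" and x: "x \<in> X.weight_space y a (of_nat j)" for j x
  proof -
    have "X'.U.at_E (g j x) ((X'.U.T ^^ j) (\<phi> w)) = X'.U.at_E (g' j x) ((X'.U.T ^^ j) (\<phi> w))" for w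
      using hom [of x w] X.R_weight_large_char [OF chars(1) j x, of w]
        X'.R_weight_large_char [OF chars(2) _ x, of "\<phi> w"] j m' by (simp add: \<phi>_at_E \<phi>_T_power)
    then have same: "X'.U.at_E (g j x) ((X'.U.T ^^ j) w) = X'.U.at_E (g' j x) ((X'.U.T ^^ j) w)" for w
      using bij by (metis bij_pointE)
    \<comment> \<open>\<open>T ^^ j\<close> maps \<open>u' (Suc j)\<close> to \<open>r\<close> times
      \<open>u' 1\<close>, where \<open>E\<close> is multiplication by \<open>X\<close>. Cancelling
      \<open>r\<close> from \<open>p1 ^ s 1\<close> leaves the modulus
      \<open>p1 ^ s (Suc j)\<close>.\<close>
    define r where "r = p1 ^ (s 1 - s (Suc j))"
    have "(X'.U.T ^^ j) (u' (Suc j)) = sm' r (u' 1)"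
      using X'.U.T_power_u [of j "Suc j"] j m' s' [of 1] s' [of "Suc j"]
      by (simp add: r_def p1')
    then have "sm' r (X'.U.at_E (g j x) (u' 1)) = sm' r (X'.U.at_E (g' j x) (u' 1))"
      using same [of "u' (Suc j)"] by (simp add: X'.U.at_E_scale)
    then have "sm' (r * (g' j x - g j x)) (u' 1) = 0"
      using X'.U.at_E_u [of 1] X'.U.m_gt_1
      by (simp add: X'.U.scale_left_diff_distrib right_diff_distrib)
    then have "p1 ^ s 1 dvd r * (g' j x - g j x)"
      using X'.U.annihilator [of 1] X'.U.m_gt_1 s' [of 1] m' by (simp add: p1')
    moreover have "s (Suc j) \<le> s 1" using X.U.s_antimono [of 1 "Suc j"] j by simp
    then have "p1 ^ s 1 = r * p1 ^ s (Suc j)" by (simp add: r_def power_add [symmetric])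
    moreover have "r \<noteq> 0" using X.U.irred by (auto simp: r_def irreducible_def)
    ultimately have dvd: "p1 ^ s (Suc j) dvd g' j x - g j x" by simp
    show ?thesis
    \<comment> \<open>Here the degree bound on the values of \<open>g j\<close> enters: it is the
      degree of the modulus, so congruent values are equal.\<close>
    proof (rule ccontr)
      assume "g' j x \<noteq> g j x"
      then have nz: "g' j x - g j x \<noteq> 0" by simp
      have "g j x \<in> poly_below (degree p1 * s (Suc j))" "g' j x \<in> poly_below (degree p1 * s (Suc j))"
        using X.g_below [OF j x] X'.g_below [of j x] j x m' s' [of "Suc j"] by (simp_all add: p1')
      then have "coeff (g' j x - g j x) k = 0" if "k \<ge> degree p1 * s (Suc j)" for k
        using that by (simp add: poly_below_def)
      then have "degree (g' j x - g j x) < degree p1 * s (Suc j)"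
        using nz by (meson leading_coeff_0_iff not_le)
      moreover have "degree (p1 ^ s (Suc j)) \<le> degree (g' j x - g j x)"
        using dvd nz by (rule dvd_imp_degree_le)
      ultimately show False
        using degree_monic_power [OF X.U.monic, of "s (Suc j)"] by (simp add: mult.commute)
    qed
  qed
  then show ?thesis using m' p1' s' by blast
qed

theorem theorem2p7:
  fixes hs :: "'f::field \<Rightarrow> 'h::ab_group_add \<Rightarrow> 'h"
    and br :: "'h \<Rightarrow> 'h \<Rightarrow> 'h"
    and y v :: 'h and a :: "'h set"
    and m :: nat and p1 :: "'f poly" and s :: "nat \<Rightarrow> nat"
    and g :: "nat \<Rightarrow> 'h \<Rightarrow> 'f poly"
    and sm :: "'f poly \<Rightarrow> 'u::ab_group_add \<Rightarrow> 'u" and u :: "nat \<Rightarrow> 'u"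
    and R :: "'h \<Rightarrow> 'u \<Rightarrow> 'u"
  assumes "lie_algebra hs br"
    and "lie_algebra.diag_semidirect hs br y a"
    and "v \<in> lie_algebra.weight_space hs br y a 1" and "v \<noteq> 0"
    and "lie_algebra.rep_data hs br y a v m p1 s g"
    and "torsion_module sm m p1 s u"
    and "R = lie_algebra.rep_R hs br y a sm m p1 s u g"
  shows "lie_rep hs br (restrict_scale sm) R \<and>
    lie_rep.linked hs br (restrict_scale sm) R \<and>
    lie_rep.nilpotency_length hs br R m \<and>
    (uniserial (lie_rep.self_module (restrict_scale sm) R) \<longleftrightarrow> (\<forall>i\<in>{1..m}. s i = 1)) \<and>
    ((CHAR('f) \<noteq> 0 \<longrightarrow> CHAR('f) \<ge> m \<and> {\<gamma>. translate_poly p1 \<gamma> = p1} = {0}) \<longrightarrow>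
      (\<forall>m' p1' s' g' (sm' :: 'f poly \<Rightarrow> 'w::ab_group_add \<Rightarrow> 'w) u'.
        lie_algebra.rep_data hs br y a v m' p1' s' g' \<and>
        torsion_module sm' m' p1' s' u' \<and>
        (m' \<noteq> m \<or> p1' \<noteq> p1 \<or> (\<exists>i\<in>{1..m}. s' i \<noteq> s i) \<or>
         (\<exists>j<m. \<exists>x\<in>lie_algebra.weight_space hs br y a (of_nat j). g' j x \<noteq> g j x)) \<longrightarrow>
        \<not> equivalent_reps (restrict_scale sm) R (restrict_scale sm')
            (lie_algebra.rep_R hs br y a sm' m' p1' s' u' g')))"
proof -
  \<comment> \<open>The module type is kept general because the fact is applied both to the given
    module and to the modified one.\<close>
  have rep: "graded_rep hs br y v a m' p1' s' g' sm' u'"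
    if "lie_algebra.rep_data hs br y a v m' p1' s' g'" and "torsion_module sm' m' p1' s' u'"
    for m' p1' s' g' u' and sm' :: "'f poly \<Rightarrow> 'x::ab_group_add \<Rightarrow> 'x"
    using that assms(1-3) by (simp add: graded_rep_def graded_rep_axioms_def)
  have rep0: "graded_rep hs br y v a m p1 s g sm u" using assms(5,6) by (rule rep)
  interpret X: graded_rep hs br y v a m p1 s g sm u by (rule rep0)
  show ?thesis
    unfolding assms(7)
  proof (intro conjI impI allI notI)
    fix m' p1' s' g' u' and sm' :: "'f poly \<Rightarrow> 'w \<Rightarrow> 'w"
    assume char: "CHAR('f) \<noteq> 0 \<longrightarrow> CHAR('f) \<ge> m \<and> {\<gamma>. translate_poly p1 \<gamma> = p1} = {0}"
      and data: "lie_algebra.rep_data hs br y a v m' p1' s' g' \<and> torsion_module sm' m' p1' s' u' \<and>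
        (m' \<noteq> m \<or> p1' \<noteq> p1 \<or> (\<exists>i\<in>{1..m}. s' i \<noteq> s i) \<or>
         (\<exists>j<m. \<exists>x\<in>lie_algebra.weight_space hs br y a (of_nat j). g' j x \<noteq> g j x))"
      and equiv: "equivalent_reps (restrict_scale sm) X.R (restrict_scale sm')
            (lie_algebra.rep_R hs br y a sm' m' p1' s' u' g')"
    have "graded_rep hs br y v a m' p1' s' g' sm' u'" using data by (intro rep) blast+
    from equivalent_imp_same_data [OF rep0 this char equiv] data show False by blast
  qed (rule X.lie_rep_axioms X.linked X.nilpotency_length_m X.uniserial_iff)+
qed

end
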